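(* Let $\mathrm{S}_n$ be the set of real stable polynomials in $\mathbb{R}[x_1,\dots,x_n]$ whose homogeneous top-degree part has nonnegative coefficients (the zero polynomial included), let $\mathrm{G}_n$ be the set of Gårding polynomials in $n$ variables, and set $\mathrm{S}=\bigcup_n\mathrm{S}_n$, $\mathrm{G}=\bigcup_n\mathrm{G}_n$. Then $\mathrm{S}_n\subseteq\mathrm{G}_n$ for every $n$ and $\mathrm{S}\subsetneq\mathrm{G}$. Moreover, the elements of $\mathrm{G}$ of degree at most $2$ are exactly the elements of $\mathrm{S}$ of degree at most $2$: $\mathrm{G}^2=\mathrm{S}^2$.
   Context: A nonzero $f\in\mathbb{R}[x_1,\dots,x_n]$ is real stable if $f(x)\ne0$ for all $x\in\mathbb{C}^n$ with $\operatorname{Im}x_i>0$ for all $i$; the zero polynomial is considered (trivially) real stable. Let $\Gamma_n^+=\{x\in\mathbb{R}^n:x_i>0\ \forall i\}$. A set $R\subset\mathbb{R}^n$ passes the positive ray test (PRT) if $R+\overline{\Gamma_n^+}\subset R$. For nonzero $f$, $\mathcal{C}_f$ is the unique nonempty connected component of $\{f>0\}$ passing PRT if it exists, and $\emptyset$ otherwise; $\mathcal{C}_0=\mathbb{R}^n$. A multi-affine polynomial (degree at most 1 in each variable) $g$ is multi-affine Gårding if $\mathcal{C}_g\neq\emptyset$. A polynomial $f\in\mathbb{R}[x_1,\dots,x_n]$ is Gårding if $f=g\circ\mu$ for some multi-affine Gårding polynomial $g$ in $m$ variables (some $m$) and some strictly positive affine map $\mu:\mathbb{R}^n\to\mathbb{R}^m$,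 $\mu(x)=Ax+b$, where $A$ has nonnegative entries and every row of $A$ has positive sum. *)

theory Defs
  imports "HOL-Analysis.Analysis" "HOL-Library.Poly_Mapping"
begin

section \<open>Real multivariate polynomials\<close>

text \<open>
  A monomial is a finitely supported exponent vector, the variables \<open>x\<^sub>1, x\<^sub>2, \<dots>\<close> being
  indexed from 0. A polynomial is a finitely supported family of coefficients. The ring of
  polynomials in the first \<open>n\<close> variables is the set \<open>polys n\<close>, so
  \<open>polys n \<subseteq> polys (Suc n)\<close>, and unions over \<open>n\<close> make sense.
\<close>

type_synonym monom = "nat \<Rightarrow>\<^sub>0 nat"
type_synonym rpoly = "monom \<Rightarrow>\<^sub>0 real"

definition polys :: "nat \<Rightarrow> rpoly set" where
  "polys n = {f. \<forall>m\<in>Poly_Mapping.keys f. Poly_Mapping.keys m \<subseteq> {..<n}}"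

definition monom_degree :: "monom \<Rightarrow> nat" where
  "monom_degree m = (\<Sum>i\<in>Poly_Mapping.keys m. Poly_Mapping.lookup m i)"

text \<open>The zero polynomial gets total degree 0.\<close>

definition total_degree :: "rpoly \<Rightarrow> nat" where
  "total_degree f = Max (insert 0 (monom_degree ` Poly_Mapping.keys f))"

definition top_part :: "rpoly \<Rightarrow> rpoly" where
  "top_part f = (\<Sum>m | m \<in> Poly_Mapping.keys f \<and> monom_degree m = total_degree f.
     Poly_Mapping.single m (Poly_Mapping.lookup f m))"

definition nonneg_coeffs :: "rpoly \<Rightarrow> bool" where
  "nonneg_coeffs f \<longleftrightarrow> (\<forall>m. 0 \<le> Poly_Mapping.lookup f m)"

definition multi_affine :: "rpoly \<Rightarrow> bool" where
  "multi_affine f \<longleftrightarrow> (\<forall>m\<in>Poly_Mapping.keys f. \<forall>i. Poly_Mapping.lookup m i \<le> 1)"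

definition eval_poly :: "rpoly \<Rightarrow> (nat \<Rightarrow> 'a) \<Rightarrow> 'a::real_field" where
  "eval_poly f x = (\<Sum>m\<in>Poly_Mapping.keys f.
     of_real (Poly_Mapping.lookup f m) * (\<Prod>i\<in>Poly_Mapping.keys m. x i ^ Poly_Mapping.lookup m i))"


section \<open>Real stable polynomials\<close>

text \<open>
  A point of \<open>\<complex>\<^sup>n\<close> is given by the first \<open>n\<close> values of \<open>x\<close>; the other values do not
  influence \<open>eval_poly f x\<close> for \<open>f \<in> polys n\<close>.
\<close>

definition real_stable :: "nat \<Rightarrow> rpoly \<Rightarrow> bool" where
  "real_stable n f \<longleftrightarrow>
     f = 0 \<or> (\<forall>x :: nat \<Rightarrow> complex. (\<forall>i<n. Im (x i) > 0) \<longrightarrow> eval_poly f x \<noteq> 0)"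

definition S_n :: "nat \<Rightarrow> rpoly set" where
  "S_n n = {f \<in> polys n. real_stable n f \<and> nonneg_coeffs (top_part f)}"

definition S_all :: "rpoly set" where
  "S_all = (\<Union>n. S_n n)"


section \<open>Garding polynomials\<close>

text \<open>
  \<open>\<real>\<^sup>n\<close> is the library's topology \<open>Euclidean_space n\<close>, whose points are the functions
  \<open>nat \<Rightarrow> real\<close> that vanish at every index \<open>i \<ge> n\<close>.
\<close>

definition pos_orthant :: "nat \<Rightarrow> (nat \<Rightarrow> real) set" where
  "pos_orthant n = {x \<in> topspace (Euclidean_space n). \<forall>i<n. x i > 0}"

definition PRT :: "nat \<Rightarrow> (nat \<Rightarrow> real) set \<Rightarrow> bool" where
  "PRT n R \<longleftrightarrow>
     (\<forall>x\<in>R. \<forall>y \<in> Euclidean_space n closure_of pos_orthant n. (\<lambda>i. x i + y i) \<in> R)"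

definition pos_set :: "nat \<Rightarrow> rpoly \<Rightarrow> (nat \<Rightarrow> real) set" where
  "pos_set n f = {x \<in> topspace (Euclidean_space n). eval_poly f x > 0}"

text \<open>The members of \<open>connected_components_of\<close> are nonempty.\<close>

definition PRT_component :: "nat \<Rightarrow> rpoly \<Rightarrow> (nat \<Rightarrow> real) set \<Rightarrow> bool" where
  "PRT_component n f C \<longleftrightarrow>
     C \<in> connected_components_of (subtopology (Euclidean_space n) (pos_set n f)) \<and> PRT n C"

definition garding_component :: "nat \<Rightarrow> rpoly \<Rightarrow> (nat \<Rightarrow> real) set" where
  "garding_component n f =
     (if f = 0 then topspace (Euclidean_space n)
      else if \<exists>!C. PRT_component n f C then (THE C. PRT_component n f C)
      else {})"

definition multi_affine_garding :: "nat \<Rightarrow> rpoly \<Rightarrow> bool" where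
  "multi_affine_garding m g \<longleftrightarrow>
     g \<in> polys m \<and> multi_affine g \<and> garding_component m g \<noteq> {}"

definition affine_map ::
    "nat \<Rightarrow> nat \<Rightarrow> (nat \<Rightarrow> nat \<Rightarrow> real) \<Rightarrow> (nat \<Rightarrow> real) \<Rightarrow> (nat \<Rightarrow> real) \<Rightarrow> nat \<Rightarrow> real" where
  "affine_map m n A b x = (\<lambda>i. if i < m then (\<Sum>j<n. A i j * x j) + b i else 0)"

definition strictly_positive_matrix :: "nat \<Rightarrow> nat \<Rightarrow> (nat \<Rightarrow> nat \<Rightarrow> real) \<Rightarrow> bool" where
  "strictly_positive_matrix m n A \<longleftrightarrow>
     (\<forall>i<m. (\<forall>j<n. 0 \<le> A i j) \<and> 0 < (\<Sum>j<n. A i j))"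

definition strictly_positive_affine ::
    "nat \<Rightarrow> nat \<Rightarrow> ((nat \<Rightarrow> real) \<Rightarrow> nat \<Rightarrow> real) \<Rightarrow> bool" where
  "strictly_positive_affine m n \<mu> \<longleftrightarrow>
     (\<exists>A b. strictly_positive_matrix m n A \<and> \<mu> = affine_map m n A b)"

text \<open>
  The equation \<open>f = g \<circ> \<mu>\<close> is stated for polynomial functions on \<open>\<real>\<^sup>n\<close>, which determine
  the real polynomial \<open>f \<in> polys n\<close>.
\<close>

definition garding :: "nat \<Rightarrow> rpoly \<Rightarrow> bool" where
  "garding n f \<longleftrightarrow> f \<in> polys n \<and>
     (\<exists>m g \<mu>. multi_affine_garding m g \<and> strictly_positive_affine m n \<mu> \<and>
        (\<forall>x \<in> topspace (Euclidean_space n). eval_poly f x = eval_poly g (\<mu> x)))"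

definition G_n :: "nat \<Rightarrow> rpoly set" where
  "G_n n = {f. garding n f}"

definition G_all :: "rpoly set" where
  "G_all = (\<Union>n. G_n n)"

end

theory Submission
  imports Defs "HOL-Computational_Algebra.Fundamental_Theorem_Algebra"
begin

text \<open>
  A multi-affine \<open>g\<close> in \<open>m\<close> variables is handled through its coefficients, a function on the
  subsets of \<open>V = {..<m}\<close>. Let \<open>K\<close> be the set of points \<open>x\<close> at which \<open>g (x + y)\<close>, as a polynomial in \<open>y\<close>,
  has nonnegative coefficients and positive constant term; these coefficients are the mixed
  derivatives of \<open>g\<close> at \<open>x\<close>. A multi-affine polynomial that is nonnegative on the closed
  orthant has nonnegative coefficients, so every subset of \<open>{g > 0}\<close> that passes the positive ray
  test lies in \<open>K\<close>; on the other hand \<open>K\<close> itself passes the test and is connected (two points are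
  joined through their componentwise maximum) and closed in \<open>{g > 0}\<close>. Hence \<open>g\<close> is Garding as
  soon as \<open>K\<close> is nonempty and open in \<open>{g > 0}\<close>. It is open when, at each of its points,
  the support of the coefficients of \<open>g (x + y)\<close> is closed under subsets: a derivative that vanishes at the
  point then vanishes identically, and the others stay positive nearby. This is
  \<open>multi_affine_garding_criterion\<close>.

  Stable polynomials are Garding. The polarisation of a stable \<open>f\<close> is multi-affine
  and stable (\<open>grace_walsh_szego\<close>, applied to one variable of \<open>f\<close> at a time), and \<open>f\<close> is recovered by
  identifying variables, which is a strictly positive linear map. A stable multi-affine polynomial
  satisfies the Rayleigh inequalities \<open>g * \<partial>\<^sub>i\<partial>\<^sub>jg \<le> \<partial>\<^sub>ig * \<partial>\<^sub>jg\<close> on the whole real space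
  (\<open>stable_imp_rayleigh\<close>), and everything else is drawn from these. They force the support condition
  (\<open>rayleigh_support_downward\<close>), and they transport the nonnegativity of the leading form from \<open>g\<close>
  to all its nonzero derivatives (\<open>positive_top_deriv\<close>), so that a point far out on the diagonal
  belongs to \<open>K\<close> (\<open>rayleigh_positive_point\<close>).

  The inclusion is strict: \<open>x\<^sub>0x\<^sub>1x\<^sub>2 - 1\<close> is Garding, its component being the part of
  \<open>{x\<^sub>0x\<^sub>1x\<^sub>2 > 1}\<close> in the positive orthant, but it vanishes when all variables equal
  a primitive cube root of unity in the upper half-plane.

  In degree at most two the converse holds. Let \<open>f = g \<circ> \<mu>\<close> be Garding and suppose
  \<open>f (u + \<i>v) = 0\<close> with \<open>v > 0\<close>. The real quadratic polynomial \<open>t \<mapsto> f (u + tv)\<close> has the root \<open>\<i>\<close>,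
  so it equals \<open>\<gamma> (1 + t\<^sup>2)\<close>. For large \<open>t\<close> the point \<open>\<mu> (u + tv)\<close> lies in the component \<open>C\<close> of \<open>g\<close>,
  whence \<open>\<gamma> > 0\<close>; then \<open>g\<close> is positive along the whole line, and the whole line lies in \<open>C\<close>. But \<open>g\<close>
  is nondecreasing in positive directions from points of \<open>C\<close>, whereas \<open>\<gamma> (1 + t\<^sup>2)\<close> decreases for
  \<open>t < 0\<close>. The leading coefficients of \<open>f\<close> are, up to positive factors, values or first or second differences
  of \<open>f\<close> in nonnegative directions at a point that \<open>\<mu>\<close> maps into \<open>C\<close>, and these are nonnegative.
\<close>

section \<open>Multi-affine polynomials as set functions\<close>

text \<open>
  The field of the arguments is left open because positivity concerns real points and stability
  complex ones, of the same coefficients.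
\<close>

definition setpoly :: "nat set \<Rightarrow> (nat set \<Rightarrow> real) \<Rightarrow> (nat \<Rightarrow> 'a) \<Rightarrow> 'a::real_field" where
  "setpoly V c x = (\<Sum>S\<in>Pow V. of_real (c S) * (\<Prod>i\<in>S. x i))"

text \<open>
  The value at \<open>x\<close> of the derivative by all variables in \<open>S\<close>, or equivalently the coefficient at \<open>S\<close>
  of the polynomial \<open>y \<mapsto> setpoly V c (\<lambda>i. x i + y i)\<close>.
\<close>

definition taylor :: "nat set \<Rightarrow> (nat set \<Rightarrow> real) \<Rightarrow> (nat \<Rightarrow> real) \<Rightarrow> nat set \<Rightarrow> real" where
  "taylor V c x S = setpoly (V - S) (\<lambda>T. c (T \<union> S)) x"

lemma setpoly_cong:
  assumes "\<And>T. T \<subseteq> V \<Longrightarrow> c T = c' T" and "\<And>i. i \<in> V \<Longrightarrow> x i = x' i"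
  shows "setpoly V c x = setpoly V c' x'"
  unfolding setpoly_def
proof (rule sum.cong[OF refl])
  fix S assume "S \<in> Pow V"
  then have "(\<Prod>i\<in>S. x i) = (\<Prod>i\<in>S. x' i)" using assms(2) by (intro prod.cong) auto
  then show "of_real (c S) * (\<Prod>i\<in>S. x i) = of_real (c' S) * (\<Prod>i\<in>S. x' i)"
    using assms(1) \<open>S \<in> Pow V\<close> by simp
qed

lemma setpoly_empty [simp]: "setpoly {} c x = of_real (c {})"
  by (simp add: setpoly_def)

lemma setpoly_insert:
  assumes "finite V" "i \<notin> V"
  shows "setpoly (insert i V) c x = setpoly V c x + x i * setpoly V (\<lambda>T. c (insert i T)) x"
proof -
  have inj: "inj_on (insert i) (Pow V)" using assms(2) by (auto simp: inj_on_def)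
  have pr: "(\<Prod>j\<in>insert i S. x j) = x i * (\<Prod>j\<in>S. x j)" if "S \<in> Pow V" for S
    using that assms by (subst prod.insert) (auto intro: finite_subset)
  have "setpoly (insert i V) c x = setpoly V c x
      + (\<Sum>S\<in>insert i ` Pow V. of_real (c S) * (\<Prod>j\<in>S. x j))"
    unfolding setpoly_def Pow_insert using assms by (intro sum.union_disjoint) auto
  also have "(\<Sum>S\<in>insert i ` Pow V. of_real (c S) * (\<Prod>j\<in>S. x j))
      = (\<Sum>S\<in>Pow V. of_real (c (insert i S)) * (x i * (\<Prod>j\<in>S. x j)))"
    by (subst sum.reindex[OF inj], unfold o_def, intro sum.cong) (use pr in auto)
  also have "\<dots> = x i * setpoly V (\<lambda>T. c (insert i T)) x"
    by (simp add: setpoly_def sum_distrib_left mult_ac)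
  finally show ?thesis .
qed

lemma setpoly_lin:
  "setpoly V (\<lambda>T. a T + k * b T) x = setpoly V a x + of_real k * setpoly V b x"
  by (simp add: setpoly_def sum.distrib sum_distrib_left algebra_simps)

lemma setpoly_sum_coeffs:
  "setpoly V (\<lambda>S. \<Sum>m\<in>M. a m * b m S) x = (\<Sum>m\<in>M. of_real (a m) * setpoly V (b m) x)"
proof -
  have "setpoly V (\<lambda>S. \<Sum>m\<in>M. a m * b m S) x =
     (\<Sum>S\<in>Pow V. \<Sum>m\<in>M. of_real (a m) * (of_real (b m S) * (\<Prod>i\<in>S. x i)))"
    by (simp add: setpoly_def sum_distrib_right mult.assoc)
  also have "\<dots> = (\<Sum>m\<in>M. \<Sum>S\<in>Pow V. of_real (a m) * (of_real (b m S) * (\<Prod>i\<in>S. x i)))"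
    by (rule sum.swap)
  finally show ?thesis by (simp add: setpoly_def sum_distrib_left)
qed

lemma setpoly_restrict:
  assumes "finite V" "W \<subseteq> V" "\<And>i. i \<in> V - W \<Longrightarrow> x i = 0"
  shows "setpoly V c x = setpoly W c x"
  unfolding setpoly_def
proof (rule sum.mono_neutral_right)
  show "finite (Pow V)" "Pow W \<subseteq> Pow V" using assms by auto
  show "\<forall>S\<in>Pow V - Pow W. of_real (c S) * (\<Prod>i\<in>S. x i) = 0"
  proof
    fix S assume S: "S \<in> Pow V - Pow W"
    then obtain i where "i \<in> S" "i \<in> V - W" by auto
    moreover have "finite S" using S assms(1) by (auto intro: finite_subset)
    ultimately show "of_real (c S) * (\<Prod>i\<in>S. x i) = 0" using assms(3) by auto
  qed
qed

lemma setpoly_of_real: "setpoly V c (\<lambda>i. of_real (x i)) = of_real (setpoly V c x)"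
  by (simp add: setpoly_def)

lemma setpoly_nonneg:
  fixes x :: "nat \<Rightarrow> real"
  assumes "\<And>S. S \<subseteq> V \<Longrightarrow> 0 \<le> c S" "\<And>i. i \<in> V \<Longrightarrow> 0 \<le> x i"
  shows "0 \<le> setpoly V c x"
  unfolding setpoly_def using assms by (intro sum_nonneg mult_nonneg_nonneg prod_nonneg) auto

lemma setpoly_mono:
  fixes x :: "nat \<Rightarrow> real"
  assumes "\<And>S. S \<subseteq> V \<Longrightarrow> 0 \<le> c S" "\<And>i. i \<in> V \<Longrightarrow> 0 \<le> x i \<and> x i \<le> y i"
  shows "setpoly V c x \<le> setpoly V c y"
  unfolding setpoly_def using assms by (intro sum_mono mult_left_mono prod_mono) auto

lemma setpoly_zero:
  assumes "finite V"
  shows "setpoly V c (\<lambda>i. 0) = of_real (c {})"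
  using setpoly_restrict[OF assms, of "{}" "\<lambda>i. 0" c] by simp

lemma taylor_empty: "taylor V c x {} = setpoly V c x"
  by (simp add: taylor_def)

lemma taylor_insert_outside:
  assumes "finite V" "i \<notin> V" "T \<subseteq> V"
  shows "taylor (insert i V) c x T = taylor V c x T + x i * taylor V (\<lambda>U. c (insert i U)) x T"
proof -
  have "insert i V - T = insert i (V - T)" using assms by auto
  then show ?thesis unfolding taylor_def using assms by (simp add: setpoly_insert)
qed

lemma taylor_insert_inside:
  assumes "i \<notin> V" "T \<subseteq> V"
  shows "taylor (insert i V) c x (insert i T) = taylor V (\<lambda>U. c (insert i U)) x T"
proof -
  have "insert i V - insert i T = V - T" using assms by auto
  then show ?thesis unfolding taylor_def by simp
qed

text \<open>
  Taylor's formula, by induction on the variables: a polynomial that is affine in \<open>x i\<close> splits as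
  \<open>g\<^sub>0 + x i * g\<^sub>1\<close>, and the coefficients of both parts expand separately.
\<close>

lemma setpoly_add:
  assumes "finite V"
  shows "setpoly V c (\<lambda>i. x i + y i) = setpoly V (taylor V c x) (y :: nat \<Rightarrow> real)"
  using assms
proof (induction V arbitrary: c rule: finite_induct)
  case empty
  then show ?case by (simp add: taylor_def)
next
  case (insert i V)
  let ?c = "\<lambda>T. c (insert i T)"
  have 1: "setpoly V (taylor (insert i V) c x) y
      = setpoly V (taylor V c x) y + x i * setpoly V (taylor V ?c x) y"
  proof -
    have "setpoly V (taylor (insert i V) c x) y
        = setpoly V (\<lambda>T. taylor V c x T + x i * taylor V ?c x T) y"
      using insert.hyps by (intro setpoly_cong taylor_insert_outside) auto
    then show ?thesis by (simp add: setpoly_lin)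
  qed
  have 2: "setpoly V (\<lambda>T. taylor (insert i V) c x (insert i T)) y = setpoly V (taylor V ?c x) y"
    using insert.hyps by (intro setpoly_cong taylor_insert_inside) auto
  show ?case
    using insert.hyps by (simp add: setpoly_insert insert.IH 1 2 algebra_simps)
qed

text \<open>
  Expanding at \<open>x\<close> and then at \<open>y\<close> is expanding at \<open>x + y\<close>. Properties of \<open>c\<close> that refer to all
  real points thereby pass to the coefficients at any point.
\<close>

lemma taylor_add:
  assumes "finite V"
  shows "taylor V c (\<lambda>i. x i + y i) S = taylor V (taylor V c x) y S"
proof -
  have "taylor V c (\<lambda>i. x i + y i) S = setpoly (V - S) (taylor (V - S) (\<lambda>T. c (T \<union> S)) x) y"
    unfolding taylor_def[of V c "\<lambda>i. x i + y i"] using assms by (intro setpoly_add) auto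
  also have "\<dots> = setpoly (V - S) (\<lambda>T. taylor V c x (T \<union> S)) y"
  proof (rule setpoly_cong)
    fix T
    have "V - S - T = V - (T \<union> S)" "(\<lambda>U. c (U \<union> T \<union> S)) = (\<lambda>U. c (U \<union> (T \<union> S)))"
      by (auto simp: Un_assoc)
    then show "taylor (V - S) (\<lambda>T. c (T \<union> S)) x T = taylor V c x (T \<union> S)"
      by (simp add: taylor_def)
  qed simp
  finally show ?thesis by (simp add: taylor_def)
qed

lemma taylor_zero:
  assumes "finite V"
  shows "taylor V c (\<lambda>i. 0) S = c S"
  using assms by (simp add: taylor_def setpoly_zero)

lemma affine_nonneg_imp:
  fixes a b :: real
  assumes "\<And>s. s \<ge> 0 \<Longrightarrow> a + s * b \<ge> 0"
  shows "a \<ge> 0" "b \<ge> 0"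
proof -
  show "a \<ge> 0" using assms[of 0] by simp
  show "b \<ge> 0"
  proof (rule ccontr)
    assume "\<not> b \<ge> 0"
    then have "a + ((a + 1) / (-b)) * b \<ge> 0" using \<open>a \<ge> 0\<close> by (intro assms divide_nonneg_pos) auto
    then show False using \<open>\<not> b \<ge> 0\<close> by (simp add: field_simps)
  qed
qed

text \<open>
  Fails for general polynomials, as \<open>x\<^sup>2 - x + 1\<close> shows. For an affine dependence on \<open>y i\<close>,
  nonnegativity for all \<open>y i \<ge> 0\<close> means that both coefficients are nonnegative, and these are again
  multi-affine in the other variables.
\<close>

lemma setpoly_coeff_nonneg:
  assumes "finite V" "\<And>y. (\<And>i. i \<in> V \<Longrightarrow> 0 \<le> y i) \<Longrightarrow> 0 \<le> setpoly V c (y :: nat \<Rightarrow> real)"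
    "S \<subseteq> V"
  shows "0 \<le> c S"
  using assms
proof (induction V arbitrary: c S rule: finite_induct)
  case empty
  then show ?case by simp
next
  case (insert i V)
  have pos: "0 \<le> setpoly V c y" "0 \<le> setpoly V (\<lambda>T. c (insert i T)) y"
    if y: "\<And>j. j \<in> V \<Longrightarrow> 0 \<le> y j" for y :: "nat \<Rightarrow> real"
  proof -
    have "setpoly V c y + s * setpoly V (\<lambda>T. c (insert i T)) y \<ge> 0" if "s \<ge> 0" for s
    proof -
      have eq: "setpoly V d (y(i := s)) = setpoly V d y" for d
        using insert.hyps by (intro setpoly_cong) auto
      have "0 \<le> setpoly (insert i V) c (y(i := s))" using y that by (intro insert.prems) auto
      then show ?thesis using insert.hyps by (simp add: setpoly_insert eq)
    qed
    from affine_nonneg_imp[OF this]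
    show "0 \<le> setpoly V c y" "0 \<le> setpoly V (\<lambda>T. c (insert i T)) y" by auto
  qed
  show ?case
  proof (cases "i \<in> S")
    case False
    then show ?thesis using insert.IH[of c S] pos(1) insert.prems by auto
  next
    case True
    then have "insert i (S - {i}) = S" by auto
    moreover have "0 \<le> c (insert i (S - {i}))"
      using insert.IH[of "\<lambda>T. c (insert i T)" "S - {i}"] pos(2) insert.prems by auto
    ultimately show ?thesis by simp
  qed
qed

section \<open>The Rayleigh inequalities and the support\<close>

text \<open>
  The inequality \<open>g * \<partial>\<^sub>i\<partial>\<^sub>jg \<le> \<partial>\<^sub>ig * \<partial>\<^sub>jg\<close> at all real points. For multi-affine real polynomials it
  characterises stability (Branden), and it survives the specialisation of variables,
  differentiation and translation, so that it can be used in inductions on the variables.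
\<close>

definition rayleigh :: "nat set \<Rightarrow> (nat set \<Rightarrow> real) \<Rightarrow> bool" where
  "rayleigh V c \<longleftrightarrow> (\<forall>x. \<forall>i\<in>V. \<forall>j\<in>V. i \<noteq> j \<longrightarrow>
     taylor V c x {} * taylor V c x {i, j} \<le> taylor V c x {i} * taylor V c x {j})"

lemma rayleighD:
  "rayleigh V c \<Longrightarrow> i \<in> V \<Longrightarrow> j \<in> V \<Longrightarrow> i \<noteq> j \<Longrightarrow>
     taylor V c x {} * taylor V c x {i, j} \<le> taylor V c x {i} * taylor V c x {j}"
  by (auto simp: rayleigh_def)

lemma rayleigh_taylor:
  assumes "finite V" "rayleigh V c"
  shows "rayleigh V (taylor V c x)"
  unfolding rayleigh_def taylor_add[OF assms(1), symmetric]
  using assms(2) by (auto simp: rayleigh_def)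

lemma rayleigh_restrict:
  assumes "finite V" "W \<subseteq> V" "rayleigh V c"
  shows "rayleigh W c"
  unfolding rayleigh_def
proof (intro allI ballI impI)
  fix x i j assume ij: "i \<in> W" "j \<in> W" "i \<noteq> (j :: nat)"
  \<comment> \<open>Setting the variables outside \<open>W\<close> to zero turns \<open>V\<close>-polynomials into \<open>W\<close>-polynomials.\<close>
  define x' where "x' = (\<lambda>k. if k \<in> W then x k else (0::real))"
  have eq: "taylor V c x' S = taylor W c x S" for S
  proof -
    have "taylor V c x' S = setpoly (W - S) (\<lambda>T. c (T \<union> S)) x'"
      unfolding taylor_def using assms by (intro setpoly_restrict) (auto simp: x'_def)
    also have "\<dots> = taylor W c x S"
      unfolding taylor_def by (intro setpoly_cong) (auto simp: x'_def)
    finally show ?thesis .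
  qed
  show "taylor W c x {} * taylor W c x {i, j} \<le> taylor W c x {i} * taylor W c x {j}"
    using rayleighD[OF assms(3), of i j x'] ij assms(2) unfolding eq by auto
qed

lemma quadratic_nonneg_imp:
  fixes a b c :: real
  assumes "\<And>s. a * s^2 + b * s + c \<ge> 0"
  shows "a \<ge> 0"
proof (rule ccontr)
  assume a: "\<not> a \<ge> 0"
  \<comment> \<open>Chosen so that \<open>a * s\<close> outweighs both \<open>b\<close> and \<open>c\<close>, with \<open>s \<ge> 1\<close>.\<close>
  define s where "s = 1 + (\<bar>b\<bar> + \<bar>c\<bar>) / (- a)"
  have s: "s \<ge> 1"
    using a divide_nonneg_pos[of "\<bar>b\<bar> + \<bar>c\<bar>" "- a"] unfolding s_def by simp
  have as: "a * s = a - \<bar>b\<bar> - \<bar>c\<bar>" using a unfolding s_def by (simp add: divide_simps)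
  have "a * s^2 + b * s + c = (a * s) * s + b * s + c" by (simp add: power2_eq_square)
  also have "\<dots> = (a - \<bar>b\<bar> - \<bar>c\<bar>) * s + b * s + c" by (simp only: as)
  also have "\<dots> = a * s - \<bar>b\<bar> * s + b * s - \<bar>c\<bar> * s + c" by (simp add: algebra_simps)
  also have "\<dots> < 0"
  proof -
    have "a * s < 0" using a s by (intro mult_neg_pos) auto
    moreover have "b * s \<le> \<bar>b\<bar> * s" using s by (intro mult_right_mono) auto
    moreover have "c \<le> \<bar>c\<bar> * s" using mult_left_mono[OF s, of "\<bar>c\<bar>"] by simp
    ultimately show ?thesis by linarith
  qed
  finally show False using assms[of s] by simp
qed

text \<open>
  The difference of the two sides of a Rayleigh inequality for \<open>g\<close> is a quadratic polynomial in
  \<open>x i\<close>; its leading coefficient is the same difference for \<open>\<partial>\<^sub>ig\<close>.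
\<close>

lemma rayleigh_deriv:
  assumes "finite V" "i \<notin> V" "rayleigh (insert i V) c"
  shows "rayleigh V (\<lambda>T. c (insert i T))"
  unfolding rayleigh_def
proof (intro allI ballI impI)
  fix x :: "nat \<Rightarrow> real" and j k assume jk: "j \<in> V" "k \<in> V" "j \<noteq> k"
  let ?c = "\<lambda>T. c (insert i T)"
  let ?A = "\<lambda>S. taylor V c x S" and ?B = "\<lambda>S. taylor V ?c x S"
  have eq: "taylor (insert i V) c (x(i := s)) S = ?A S + s * ?B S" if "S \<subseteq> V" for S s
  proof -
    have "taylor V d (x(i := s)) S = taylor V d x S" for d
      unfolding taylor_def using assms(2) by (intro setpoly_cong) auto
    then show ?thesis using taylor_insert_outside[OF assms(1,2) that] by simp
  qed
  have "(?B {j} * ?B {k} - ?B {} * ?B {j,k}) * s^2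
      + (?A {j} * ?B {k} + ?B {j} * ?A {k} - ?A {} * ?B {j,k} - ?B {} * ?A {j,k}) * s
      + (?A {j} * ?A {k} - ?A {} * ?A {j,k}) \<ge> 0" for s
    using rayleighD[OF assms(3), of j k "x(i := s)"] jk
    by (simp add: eq algebra_simps power2_eq_square)
  from quadratic_nonneg_imp[OF this]
  show "?B {} * ?B {j, k} \<le> ?B {j} * ?B {k}" by simp
qed

lemma rayleigh_pair:
  assumes "finite V" "rayleigh V c" "i \<in> V" "j \<in> V" "i \<noteq> j"
  shows "c {} * c {i, j} \<le> c {i} * c {j}"
  using rayleighD[OF assms(2-), of "\<lambda>i. 0"] by (simp add: taylor_zero[OF assms(1)])

text \<open>
  Consider a minimal nonempty set \<open>S\<close> in the support. In the variables of \<open>S\<close> the polynomial is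
  \<open>c {} + c S * x\<^sup>S\<close>, and if \<open>S\<close> had two or more elements, the Rayleigh inequality at the point
  with all coordinates 1 would read \<open>(c {} + c S) * c S \<le> c S * c S\<close>.
\<close>

lemma rayleigh_singleton_exists:
  assumes "finite V" "rayleigh V c" "\<And>S. S \<subseteq> V \<Longrightarrow> 0 \<le> c S" "0 < c {}" "0 < c V" "V \<noteq> {}"
  shows "\<exists>i\<in>V. 0 < c {i}"
proof -
  define F where "F = {S. S \<subseteq> V \<and> S \<noteq> {} \<and> 0 < c S}"
  have "finite F" "V \<in> F" unfolding F_def using assms by auto
  then obtain S where S: "S \<in> F" "\<And>T. T \<in> F \<Longrightarrow> T \<subseteq> S \<Longrightarrow> T = S"
    using finite_has_minimal[of F] by blast
  have fS: "finite S" and SV: "S \<subseteq> V" and cS: "0 < c S" and neS: "S \<noteq> {}"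
    using S(1) assms(1) unfolding F_def by (auto intro: finite_subset)
  have zero: "c T = 0" if "T \<subseteq> S" "T \<noteq> {}" "T \<noteq> S" for T
    using S(2)[of T] that SV assms(3)[of T] unfolding F_def by fastforce
  obtain i where i: "i \<in> S" using neS by auto
  show ?thesis
  proof (cases "S = {i}")
    case True
    then show ?thesis using cS SV by auto
  next
    case False
    then obtain j where j: "j \<in> S" "j \<noteq> i" using i by auto
    have R: "rayleigh S c" using assms(1,2) SV by (blast intro: rayleigh_restrict)
    have top: "taylor S c (\<lambda>i. 1) U = c S" if U: "U \<subseteq> S" "U \<noteq> {}" for U
    proof -
      have "taylor S c (\<lambda>i. 1) U = (\<Sum>T\<in>Pow (S - U). c (T \<union> U))"
        by (simp add: taylor_def setpoly_def)
      also have "\<dots> = (\<Sum>T\<in>{S - U}. c (T \<union> U))"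
      proof (rule sum.mono_neutral_right)
        show "\<forall>T\<in>Pow (S - U) - {S - U}. c (T \<union> U) = 0" using U by (intro ballI zero) auto
      qed (use fS in auto)
      also have "\<dots> = c S" using U by (simp add: Un_absorb2)
      finally show ?thesis .
    qed
    have bot: "taylor S c (\<lambda>i. 1) {} = c {} + c S"
    proof -
      have "taylor S c (\<lambda>i. 1) {} = (\<Sum>T\<in>Pow S. c T)"
        by (simp add: taylor_def setpoly_def)
      also have "\<dots> = (\<Sum>T\<in>{{}, S}. c T)"
        by (rule sum.mono_neutral_right) (use fS zero in auto)
      finally show ?thesis using neS by simp
    qed
    have "(c {} + c S) * c S \<le> c S * c S"
      using rayleighD[OF R i j(1), of "\<lambda>i. 1"] i j by (simp add: top bot)
    then show ?thesis using cS assms(4) by (simp add: algebra_simps mult_le_0_iff)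
  qed
qed

text \<open>
  It suffices to treat \<open>T\<close> as the set of all variables. Some singleton \<open>{i}\<close> is in the support; the
  induction hypothesis for \<open>\<partial>\<^sub>ig\<close> puts all sets containing \<open>i\<close> into the support, in particular the
  pairs \<open>{i, j}\<close>. The Rayleigh inequality for \<open>i\<close> and \<open>j\<close> at the origin then yields all singletons
  \<open>{j}\<close>, and the induction hypothesis for \<open>\<partial>\<^sub>jg\<close> all nonempty sets.
\<close>

lemma rayleigh_support_downward:
  assumes "finite V" "rayleigh V c" "\<And>S. S \<subseteq> V \<Longrightarrow> 0 \<le> c S" "0 < c {}"
    and "T \<subseteq> V" "0 < c T" "S \<subseteq> T"
  shows "0 < c S"
proof -
  have "finite T" using assms by (auto intro: finite_subset)
  moreover have "rayleigh T c" using assms by (blast intro: rayleigh_restrict)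
  moreover have "\<And>S. S \<subseteq> T \<Longrightarrow> 0 \<le> c S" using assms by blast
  ultimately show ?thesis using assms(4,6,7)
  proof (induction "card T" arbitrary: T c S)
    case 0
    then show ?case by simp
  next
    case (Suc n)
    note fin = \<open>finite T\<close> and R = \<open>rayleigh T c\<close> and nn = Suc.prems(3)
    have deriv: "0 < c S'" if i: "i \<in> T" "0 < c {i}" and S': "i \<in> S'" "S' \<subseteq> T" for i S'
    proof -
      have T: "insert i (T - {i}) = T" "insert i (S' - {i}) = S'" using i S' by auto
      have "0 < c (insert i (S' - {i}))"
      proof (rule Suc.hyps(1)[of "T - {i}" "\<lambda>T. c (insert i T)"])
        show "n = card (T - {i})" using Suc.hyps(2) i fin by simp
        show "rayleigh (T - {i}) (\<lambda>T. c (insert i T))"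
          using R T fin by (intro rayleigh_deriv) auto
        show "\<And>S. S \<subseteq> T - {i} \<Longrightarrow> 0 \<le> c (insert i S)" using i by (intro nn) auto
      qed (use i S' T fin nn Suc.prems in auto)
      then show ?thesis by (simp only: T)
    qed
    have "T \<noteq> {}" using Suc.hyps(2) by auto
    then obtain i where i: "i \<in> T" "0 < c {i}"
      using rayleigh_singleton_exists[OF fin R nn] Suc.prems by auto
    have single: "0 < c {j}" if j: "j \<in> T" for j
    proof (cases "j = i")
      case False
      have "0 < c {i, j}" using i j by (intro deriv[OF i]) auto
      then have "0 < c {} * c {i, j}" using Suc.prems by simp
      also have "\<dots> \<le> c {i} * c {j}" using i j False by (intro rayleigh_pair[OF fin R]) auto
      finally show ?thesis using i by (simp add: zero_less_mult_iff)
    qed (use i in simp)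
    show ?case
    proof (cases "S = {}")
      case False
      then obtain j where "j \<in> S" by auto
      then show ?thesis using deriv[of j S] single[of j] \<open>S \<subseteq> T\<close> by auto
    qed (use Suc.prems in simp)
  qed
qed

section \<open>The Rayleigh inequalities and the leading form\<close>

text \<open>
  The leading form has nonnegative coefficients. The last conjunct makes \<open>D\<close> the degree and excludes
  the zero polynomial.
\<close>

definition positive_top :: "nat set \<Rightarrow> (nat set \<Rightarrow> real) \<Rightarrow> bool" where
  "positive_top V c \<longleftrightarrow> (\<exists>D. (\<forall>S. S \<subseteq> V \<longrightarrow> D < card S \<longrightarrow> c S = 0)
     \<and> (\<forall>S. S \<subseteq> V \<longrightarrow> card S = D \<longrightarrow> 0 \<le> c S) \<and> (\<exists>S. S \<subseteq> V \<and> card S = D \<and> 0 < c S))"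

lemma tendsto_leading_coeff:
  fixes a :: "'b \<Rightarrow> real"
  assumes "finite F" "\<And>T. T \<in> F \<Longrightarrow> D < k T \<Longrightarrow> a T = 0"
  shows "((\<lambda>s. (\<Sum>T\<in>F. a T * s ^ k T) / s ^ D) \<longlongrightarrow> (\<Sum>T\<in>{T\<in>F. k T = D}. a T)) at_top"
proof -
  have summand: "((\<lambda>s. a T * s ^ k T / s ^ D) \<longlongrightarrow> (if k T = D then a T else 0)) at_top"
    if T: "T \<in> F" for T
  proof -
    consider "D < k T" | "k T = D" | "k T < D" by linarith
    then show ?thesis
    proof cases
      case 1
      then show ?thesis using assms(2)[OF T] by simp
    next
      case 2
      have "eventually (\<lambda>s. a T * s ^ k T / s ^ D = a T) at_top"
        using eventually_gt_at_top[of 0] by eventually_elim (use 2 in auto)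
      then show ?thesis using 2 by (simp add: tendsto_eventually)
    next
      case 3
      have "filterlim (\<lambda>s::real. s ^ (D - k T)) at_top at_top"
        using 3 by (intro filterlim_pow_at_top filterlim_ident) auto
      then have "((\<lambda>s. a T * inverse (s ^ (D - k T))) \<longlongrightarrow> a T * 0) at_top"
        by (intro tendsto_mult tendsto_const)
           (rule filterlim_compose[OF tendsto_inverse_0_at_top[OF filterlim_ident]])
      moreover have "eventually (\<lambda>s. a T * inverse (s ^ (D - k T)) = a T * s ^ k T / s ^ D) at_top"
        using eventually_gt_at_top[of 0]
      proof eventually_elim
        case (elim s)
        have "s ^ D = s ^ (D - k T) * s ^ k T" using 3 by (simp flip: power_add)
        then show ?case using elim by (simp add: field_simps)
      qed
      ultimately show ?thesis using 3 by (auto intro: Lim_transform_eventually)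
    qed
  qed
  have "((\<lambda>s. \<Sum>T\<in>F. a T * s ^ k T / s ^ D) \<longlongrightarrow> (\<Sum>T\<in>F. if k T = D then a T else 0)) at_top"
    by (intro tendsto_sum summand)
  moreover have "(\<Sum>T\<in>F. if k T = D then a T else 0) = (\<Sum>T\<in>{T\<in>F. k T = D}. a T)"
    using assms(1) by (simp add: sum.inter_filter)
  ultimately show ?thesis by (simp add: sum_divide_distrib)
qed

lemma setpoly_scaled:
  fixes y :: "nat \<Rightarrow> real"
  shows "setpoly V c (\<lambda>j. s * y j) = (\<Sum>S\<in>Pow V. c S * (\<Prod>j\<in>S. y j) * s ^ card S)"
  by (simp add: setpoly_def prod.distrib mult_ac)

lemma positive_top_eventually:
  assumes "finite V" "positive_top V c"
  shows "eventually (\<lambda>s::real. 0 < setpoly V c (\<lambda>_. s)) at_top"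
proof -
  obtain D where D: "\<And>S. S \<subseteq> V \<Longrightarrow> D < card S \<Longrightarrow> c S = 0"
      "\<And>S. S \<subseteq> V \<Longrightarrow> card S = D \<Longrightarrow> 0 \<le> c S" "\<exists>S. S \<subseteq> V \<and> card S = D \<and> 0 < c S"
    using assms(2) unfolding positive_top_def by blast
  have "((\<lambda>s. (\<Sum>T\<in>Pow V. c T * s ^ card T) / s ^ D) \<longlongrightarrow> (\<Sum>T\<in>{T\<in>Pow V. card T = D}. c T)) at_top"
    using assms(1) D by (intro tendsto_leading_coeff) auto
  moreover have "0 < (\<Sum>T\<in>{T\<in>Pow V. card T = D}. c T)"
  proof -
    obtain S where "S \<subseteq> V" "card S = D" "0 < c S" using D(3) by auto
    then show ?thesis using D(2) assms(1) by (intro sum_pos2[of _ S]) auto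
  qed
  ultimately have "eventually (\<lambda>s. 0 < (\<Sum>T\<in>Pow V. c T * s ^ card T) / s ^ D) at_top"
    by (rule order_tendstoD)
  from this eventually_gt_at_top[of "0::real"] show ?thesis
  proof eventually_elim
    case (elim s)
    then show ?case using setpoly_scaled[of V c s "\<lambda>_. 1"]
      by (simp add: zero_less_divide_iff)
  qed
qed

text \<open>
  Euler's identity: \<open>\<Sum>\<^sub>j x\<^sub>j\<partial>\<^sub>j\<close> multiplies each monomial by its degree.
\<close>

lemma setpoly_euler:
  fixes x :: "nat \<Rightarrow> real"
  assumes "finite V"
  shows "(\<Sum>j\<in>V. x j * taylor V c x {j}) = setpoly V (\<lambda>S. real (card S) * c S) x"
  using assms
proof (induction V arbitrary: c rule: finite_induct)
  case (insert i V)
  let ?c = "\<lambda>T. c (insert i T)"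
  have "(\<Sum>j\<in>insert i V. x j * taylor (insert i V) c x {j})
     = x i * setpoly V ?c x + (\<Sum>j\<in>V. x j * (taylor V c x {j} + x i * taylor V ?c x {j}))"
    using insert.hyps taylor_insert_inside[of i V "{}" c x]
    by (simp add: taylor_empty taylor_insert_outside)
  also have "\<dots> = x i * setpoly V ?c x + (\<Sum>j\<in>V. x j * taylor V c x {j})
      + x i * (\<Sum>j\<in>V. x j * taylor V ?c x {j})"
    by (simp add: sum.distrib sum_distrib_left algebra_simps)
  also have "\<dots> = x i * setpoly V ?c x + setpoly V (\<lambda>S. real (card S) * c S) x
      + x i * setpoly V (\<lambda>S. real (card S) * ?c S) x"
    by (simp only: insert.IH)
  also have "\<dots> = setpoly V (\<lambda>S. real (card S) * c S) x
      + x i * setpoly V (\<lambda>S. ?c S + 1 * (real (card S) * ?c S)) x"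
    unfolding setpoly_lin by (simp add: algebra_simps)
  also have "setpoly V (\<lambda>S. ?c S + 1 * (real (card S) * ?c S)) x
      = setpoly V (\<lambda>S. real (card (insert i S)) * ?c S) x"
  proof (rule setpoly_cong)
    fix T assume "T \<subseteq> V"
    then have "card (insert i T) = Suc (card T)"
      using insert.hyps by (intro card_insert_disjoint) (auto intro: finite_subset)
    then show "?c T + 1 * (real (card T) * ?c T) = real (card (insert i T)) * ?c T"
      by (simp add: algebra_simps)
  qed simp
  finally show ?case using insert.hyps by (simp add: setpoly_insert)
qed simp

text \<open>
  Let \<open>Q\<close> be the part of \<open>g\<close> free of \<open>x i\<close>, of degree \<open>D\<close> with leading form \<open>h\<close>, and let
  \<open>q = \<partial>\<^sub>ig\<close>, of degree at most \<open>E < D\<close> with degree-\<open>E\<close> part \<open>k\<close>. At \<open>x i = 0\<close> the Rayleigh inequalities read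
  \<open>Q * \<partial>\<^sub>jq \<le> q * \<partial>\<^sub>jQ\<close>. Weighted by \<open>x\<^sub>j\<close> and summed over \<open>j\<close>, the leading terms along the ray
  through \<open>y\<close> give \<open>h(y) * E * k(y) \<le> k(y) * D * h(y)\<close> by Euler's identity, hence \<open>k(y) \<ge> 0\<close>.
\<close>

lemma rayleigh_leading_form_deriv_nonneg:
  fixes y :: "nat \<Rightarrow> real"
  assumes "finite V" "i \<notin> V" and R: "rayleigh (insert i V) c"
    and topD: "\<And>S. S \<subseteq> V \<Longrightarrow> D < card S \<Longrightarrow> c S = 0"
    and posD: "0 < (\<Sum>S\<in>{S\<in>Pow V. card S = D}. c S * (\<Prod>j\<in>S. y j))"
    and topE: "\<And>S. S \<subseteq> V \<Longrightarrow> E < card S \<Longrightarrow> c (insert i S) = 0"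
    and "E < D" and y: "\<And>j. 0 \<le> y j"
  shows "0 \<le> (\<Sum>S\<in>{S\<in>Pow V. card S = E}. c (insert i S) * (\<Prod>j\<in>S. y j))" (is "0 \<le> ?k")
proof -
  let ?h = "\<Sum>S\<in>{S\<in>Pow V. card S = D}. c S * (\<Prod>j\<in>S. y j)"
  let ?c = "\<lambda>T. c (insert i T)"
  let ?x = "\<lambda>s j. s * y j"
  let ?eu = "\<lambda>d s. setpoly V (\<lambda>S. real (card S) * d S) (?x s)"
  have ineq: "setpoly V c (?x s) * ?eu ?c s \<le> setpoly V ?c (?x s) * ?eu c s" if s: "s \<ge> 0" for s
  proof -
    \<comment> \<open>At \<open>x i = 0\<close> the derivatives reduce to those of \<open>Q\<close> and \<open>q\<close>.\<close>
    define x where "x = (?x s)(i := 0)"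
    have xe: "setpoly V d x = setpoly V d (?x s)" for d
      unfolding x_def using assms(2) by (intro setpoly_cong) auto
    have "setpoly V c x * taylor V ?c x {j} \<le> setpoly V ?c x * taylor V c x {j}" if j: "j \<in> V" for j
    proof -
      have ij: "i \<noteq> j" using j assms(2) by auto
      have xi: "x i = 0" by (simp add: x_def)
      show ?thesis
        using rayleighD[OF R, of i j x] ij j assms(1,2) taylor_insert_inside[of i V "{}" c x]
          taylor_insert_inside[of i V "{j}" c x]
        by (simp add: taylor_insert_outside xi taylor_empty setpoly_insert)
    qed
    then have "(\<Sum>j\<in>V. x j * (setpoly V c x * taylor V ?c x {j}))
        \<le> (\<Sum>j\<in>V. x j * (setpoly V ?c x * taylor V c x {j}))"
      using s y by (intro sum_mono mult_left_mono) (auto simp: x_def)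
    then have "setpoly V c x * (\<Sum>j\<in>V. x j * taylor V ?c x {j})
        \<le> setpoly V ?c x * (\<Sum>j\<in>V. x j * taylor V c x {j})"
      by (simp add: sum_distrib_left mult_ac)
    then show ?thesis unfolding setpoly_euler[OF assms(1)] xe .
  qed
  have lim: "((\<lambda>s. setpoly V d (?x s) / s ^ N) \<longlongrightarrow> (\<Sum>S\<in>{S\<in>Pow V. card S = N}. d S * (\<Prod>j\<in>S. y j))) at_top"
    if "\<And>S. S \<subseteq> V \<Longrightarrow> N < card S \<Longrightarrow> d S = 0" for d N
    unfolding setpoly_scaled using assms(1) that by (intro tendsto_leading_coeff) auto
  have lc: "((\<lambda>s. setpoly V c (?x s) / s ^ D) \<longlongrightarrow> ?h) at_top"
    using topD by (intro lim) auto
  have lc': "((\<lambda>s. setpoly V ?c (?x s) / s ^ E) \<longlongrightarrow> ?k) at_top"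
    using topE by (intro lim) auto
  have le: "((\<lambda>s. ?eu c s / s ^ D) \<longlongrightarrow> D * ?h) at_top"
  proof -
    have "(\<Sum>S\<in>{S\<in>Pow V. card S = D}. real (card S) * c S * (\<Prod>j\<in>S. y j)) = D * ?h"
      unfolding sum_distrib_left by (intro sum.cong) auto
    then show ?thesis using lim[of D "\<lambda>S. real (card S) * c S"] topD by simp
  qed
  have le': "((\<lambda>s. ?eu ?c s / s ^ E) \<longlongrightarrow> E * ?k) at_top"
  proof -
    have "(\<Sum>S\<in>{S\<in>Pow V. card S = E}. real (card S) * ?c S * (\<Prod>j\<in>S. y j)) = E * ?k"
      unfolding sum_distrib_left by (intro sum.cong) auto
    then show ?thesis using lim[of E "\<lambda>S. real (card S) * ?c S"] topE by simp
  qed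
  have "?h * (E * ?k) \<le> ?k * (D * ?h)"
  proof (rule tendsto_le[OF _ tendsto_mult[OF lc' le] tendsto_mult[OF lc le']])
    show "\<forall>\<^sub>F s in at_top. setpoly V c (?x s) / s ^ D * (?eu ?c s / s ^ E)
        \<le> setpoly V ?c (?x s) / s ^ E * (?eu c s / s ^ D)"
      using eventually_gt_at_top[of 0]
    proof eventually_elim
      case (elim s)
      have "(setpoly V c (?x s) * ?eu ?c s) / (s ^ D * s ^ E)
          \<le> (setpoly V ?c (?x s) * ?eu c s) / (s ^ D * s ^ E)"
        using ineq[of s] elim by (intro divide_right_mono) auto
      then show ?case by (simp add: mult_ac)
    qed
  qed simp
  then have "0 \<le> ((real D - real E) * ?h) * ?k" by (simp add: algebra_simps)
  moreover have "0 < (real D - real E) * ?h" using \<open>E < D\<close> posD by simp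
  ultimately show ?thesis by (simp add: zero_le_mult_iff)
qed

text \<open>
  If \<open>\<partial>\<^sub>ig\<close> has degree one less than \<open>g\<close>, its leading form is \<open>\<partial>\<^sub>i\<close> of the leading form of \<open>g\<close>. Otherwise
  the leading form of \<open>g\<close> does not contain \<open>x i\<close>, and the leading form \<open>k\<close> of \<open>\<partial>\<^sub>ig\<close> is nonnegative on the
  open positive orthant by the previous lemma. Since \<open>k\<close> is homogeneous and multi-affine, its
  coefficient at \<open>T\<close> is its value at the indicator vector of \<open>T\<close>, a limit of positive points.
\<close>

lemma positive_top_deriv:
  assumes "finite V" "i \<notin> V" and R: "rayleigh (insert i V) c"
    and P: "positive_top (insert i V) c"
  shows "(\<forall>T. T \<subseteq> V \<longrightarrow> c (insert i T) = 0) \<or> positive_top V (\<lambda>T. c (insert i T))"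
proof (cases "\<forall>T. T \<subseteq> V \<longrightarrow> c (insert i T) = 0")
  case False
  let ?c = "\<lambda>T. c (insert i T)"
  have ci: "card (insert i T) = Suc (card T)" if "T \<subseteq> V" for T
    using that assms(1,2) by (intro card_insert_disjoint) (auto intro: finite_subset)
  obtain D where D: "\<And>S. S \<subseteq> insert i V \<Longrightarrow> D < card S \<Longrightarrow> c S = 0"
      "\<And>S. S \<subseteq> insert i V \<Longrightarrow> card S = D \<Longrightarrow> 0 \<le> c S"
      "\<exists>S. S \<subseteq> insert i V \<and> card S = D \<and> 0 < c S"
    using P unfolding positive_top_def by blast
  have D2: "0 \<le> c S" if "S \<subseteq> V" "card S = D" for S using D(2)[of S] that by blast
  define N where "N = {T \<in> Pow V. ?c T \<noteq> 0}"
  define E where "E = Max (card ` N)"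
  have fin: "finite (card ` N)" "card ` N \<noteq> {}" unfolding N_def using assms(1) False by auto
  have topE: "?c T = 0" if "T \<subseteq> V" "E < card T" for T
  proof (rule ccontr)
    assume "?c T \<noteq> 0"
    then have "card T \<le> E" unfolding E_def using that fin by (intro Max_ge) (auto simp: N_def)
    then show False using that by simp
  qed
  obtain T1 where T1: "T1 \<subseteq> V" "?c T1 \<noteq> 0" "card T1 = E"
    using Max_in[OF fin] unfolding E_def N_def by auto
  have ED: "Suc E \<le> D"
    using D(1)[of "insert i T1"] T1 ci[of T1] insert_mono[of T1 V i] by linarith
  have nonneg: "0 \<le> ?c T" if T: "T \<subseteq> V" "card T = E" for T
  proof (cases "Suc E = D")
    case True
    then show ?thesis using D(2)[of "insert i T"] T ci[of T] by auto
  next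
    case False
    let ?k = "\<lambda>y. \<Sum>S\<in>{S\<in>Pow V. card S = E}. ?c S * (\<Prod>j\<in>S. y j)"
    \<comment> \<open>Positive points that tend to the indicator vector of \<open>T\<close> as \<open>e\<close> tends to 0.\<close>
    define y where "y = (\<lambda>e j. if j \<in> T then 1 else (e::real))"
    have pos: "0 \<le> ?k (y e)" if e: "e > 0" for e
    proof (rule rayleigh_leading_form_deriv_nonneg[OF assms(1,2) R, where D = D])
      have yp: "0 < y e j" for j using e by (simp add: y_def)
      obtain S where S: "S \<subseteq> insert i V" "card S = D" "0 < c S" using D(3) by auto
      have "i \<notin> S"
      proof
        assume "i \<in> S"
        then have "insert i (S - {i}) = S" by auto
        moreover have "S - {i} \<subseteq> V" using S by auto
        ultimately show False using topE[of "S - {i}"] ci[of "S - {i}"] S False ED by simp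
      qed
      then have "S \<subseteq> V" using S by auto
      then show "0 < (\<Sum>S\<in>{S\<in>Pow V. card S = D}. c S * (\<Prod>j\<in>S. y e j))"
        using S D2 assms(1) yp
        by (intro sum_pos2[of _ S] mult_pos_pos mult_nonneg_nonneg prod_nonneg prod_pos)
          (auto intro: less_imp_le)
      show "0 \<le> y e j" for j using yp[of j] by simp
      show "c S = 0" if "S \<subseteq> V" "D < card S" for S using D(1)[of S] that by blast
    qed (use topE ED False in auto)
    have "((\<lambda>e. ?k (y e)) \<longlongrightarrow> ?k (y 0)) (at_right 0)"
    proof (intro tendsto_intros)
      show "((\<lambda>e. y e j) \<longlongrightarrow> y 0 j) (at_right 0)" for j
        by (cases "j \<in> T") (auto simp: y_def intro: tendsto_ident_at)
    qed
    moreover have "\<forall>\<^sub>F e in at_right 0. 0 \<le> ?k (y e)"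
      using pos by (auto simp: eventually_at_right_field intro: exI[of _ 1])
    ultimately have "0 \<le> ?k (y 0)"
      by (intro tendsto_lowerbound[where F = "at_right 0"]) auto
    also have "?k (y 0) = (\<Sum>S\<in>{T}. ?c S * (\<Prod>j\<in>S. y 0 j))"
    proof (rule sum.mono_neutral_right)
      show "\<forall>S\<in>{S\<in>Pow V. card S = E} - {T}. ?c S * (\<Prod>j\<in>S. y 0 j) = 0"
      proof
        fix S assume S: "S \<in> {S\<in>Pow V. card S = E} - {T}"
        then have fS: "finite S" "finite T" using T assms(1) by (auto intro: finite_subset)
        then have "\<not> S \<subseteq> T" using S T card_subset_eq[of T S] by auto
        then obtain j where "j \<in> S" "j \<notin> T" by auto
        then show "?c S * (\<Prod>j\<in>S. y 0 j) = 0" using fS by (auto simp: y_def)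
      qed
    qed (use T assms(1) in auto)
    also have "\<dots> = ?c T" by (simp add: y_def)
    finally show ?thesis .
  qed
  have "positive_top V ?c" unfolding positive_top_def
  proof (intro exI[of _ E] conjI allI impI)
    show "\<exists>S. S \<subseteq> V \<and> card S = E \<and> 0 < ?c S"
      using T1 nonneg[OF T1(1,3)] by (intro exI[of _ T1]) auto
  qed (use topE nonneg in auto)
  then show ?thesis by simp
qed simp

lemma rayleigh_derivs_positive_top:
  assumes "finite V" "rayleigh V c" "positive_top V c" "S \<subseteq> V"
  shows "rayleigh (V - S) (\<lambda>T. c (T \<union> S)) \<and>
    ((\<forall>T. T \<subseteq> V - S \<longrightarrow> c (T \<union> S) = 0) \<or> positive_top (V - S) (\<lambda>T. c (T \<union> S)))"
proof -
  have "finite S" using assms by (auto intro: finite_subset)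
  then show ?thesis using assms(4)
  proof (induction S rule: finite_induct)
    case empty
    then show ?case using assms by simp
  next
    case (insert j S)
    let ?c = "\<lambda>T. c (T \<union> S)" and ?W = "V - insert j S"
    have W: "insert j ?W = V - S" "finite ?W" "j \<notin> ?W" using insert assms(1) by auto
    have IH: "rayleigh (insert j ?W) ?c"
      "(\<forall>T. T \<subseteq> insert j ?W \<longrightarrow> ?c T = 0) \<or> positive_top (insert j ?W) ?c"
      using insert unfolding W(1) by auto
    have eq: "(\<lambda>T. ?c (insert j T)) = (\<lambda>T. c (T \<union> insert j S))" by simp
    have "(\<forall>T. T \<subseteq> ?W \<longrightarrow> ?c (insert j T) = 0) \<or> positive_top ?W (\<lambda>T. ?c (insert j T))"
      using IH(2) positive_top_deriv[OF W(2,3) IH(1)] by (meson insert_mono)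
    then show ?case using rayleigh_deriv[OF W(2,3) IH(1)] unfolding eq by auto
  qed
qed

text \<open>
  On the diagonal, each nonzero derivative is eventually positive because its leading form has
  nonnegative coefficients.
\<close>

lemma rayleigh_positive_point:
  assumes "finite V" "rayleigh V c" "positive_top V c"
  shows "\<exists>s. 0 < taylor V c (\<lambda>_. s) {} \<and> (\<forall>S. S \<subseteq> V \<longrightarrow> 0 \<le> taylor V c (\<lambda>_. s) S)"
proof -
  have "eventually (\<lambda>s. 0 \<le> taylor V c (\<lambda>_. s) S) at_top" if S: "S \<subseteq> V" for S
  proof (cases "\<forall>T. T \<subseteq> V - S \<longrightarrow> c (T \<union> S) = 0")
    case True
    then have "taylor V c (\<lambda>_. s) S = 0" for s unfolding taylor_def setpoly_def by simp
    then show ?thesis by simp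
  next
    case False
    then have "positive_top (V - S) (\<lambda>T. c (T \<union> S))"
      using rayleigh_derivs_positive_top[OF assms S] by auto
    then have "eventually (\<lambda>s. 0 < taylor V c (\<lambda>_. s) S) at_top"
      unfolding taylor_def using assms(1) by (intro positive_top_eventually) auto
    then show ?thesis by eventually_elim simp
  qed
  then have "eventually (\<lambda>s. \<forall>S\<in>Pow V. 0 \<le> taylor V c (\<lambda>_. s) S) at_top"
    using assms(1) by (intro eventually_ball_finite) auto
  moreover have "eventually (\<lambda>s. 0 < taylor V c (\<lambda>_. s) {}) at_top"
    unfolding taylor_empty using assms by (intro positive_top_eventually) auto
  ultimately have "eventually (\<lambda>s. 0 < taylor V c (\<lambda>_. s) {} \<and>
      (\<forall>S\<in>Pow V. 0 \<le> taylor V c (\<lambda>_. s) S)) at_top"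
    by eventually_elim auto
  from eventually_happens'[OF trivial_limit_at_top_linorder this] show ?thesis by auto
qed

section \<open>Stable multi-affine polynomials are Rayleigh\<close>

text \<open>
  With all variables but \<open>x i\<close> and \<open>x j\<close> fixed at real values, the polynomial is
  \<open>\<alpha> + \<beta> x\<^sub>i + \<gamma> x\<^sub>j + \<delta> x\<^sub>i x\<^sub>j\<close>, and both sides of the Rayleigh inequality differ by
  \<open>\<beta>\<gamma> - \<alpha>\<delta>\<close>. If this is negative, then \<open>x\<^sub>i = \<i>\<close> forces the zero
  \<open>x\<^sub>j = - (\<alpha> + \<beta>\<i>) / (\<gamma> + \<delta>\<i>)\<close>, which has positive imaginary part. This persists when the
  fixed variables are moved slightly into the upper half-plane, against stability.
\<close>

lemma stable_imp_rayleigh: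
  assumes "finite V"
    and stable: "\<And>z :: nat \<Rightarrow> complex. (\<And>i. i \<in> V \<Longrightarrow> 0 < Im (z i)) \<Longrightarrow> setpoly V c z \<noteq> 0"
  shows "rayleigh V c"
  unfolding rayleigh_def
proof (intro allI ballI impI)
  fix x :: "nat \<Rightarrow> real" and i j assume ij: "i \<in> V" "j \<in> V" "i \<noteq> j"
  define W where "W = V - {i, j}"
  have W: "finite W" "i \<notin> insert j W" "j \<notin> W" "V = insert i (insert j W)"
    using ij assms(1) by (auto simp: W_def)
  let ?a = "c" and ?b = "\<lambda>T. c (insert i T)" and ?g = "\<lambda>T. c (insert j T)"
    and ?d = "\<lambda>T. c (insert i (insert j T))"
  define P where "P = (\<lambda>d. setpoly W d x)"
  have expand: "setpoly V c z = setpoly W ?a z + z j * setpoly W ?g z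
      + z i * (setpoly W ?b z + z j * setpoly W ?d z)" for z :: "nat \<Rightarrow> 'a::real_field"
    using W by (simp add: setpoly_insert)
  have t0: "taylor V c x {} = P ?a + x j * P ?g + x i * (P ?b + x j * P ?d)"
    unfolding taylor_empty expand P_def ..
  have ti: "taylor V c x {i} = P ?b + x j * P ?d"
  proof -
    have "V - {i} = insert j W" using W by auto
    then show ?thesis using W by (simp add: taylor_def setpoly_insert P_def insert_commute)
  qed
  have tj: "taylor V c x {j} = P ?g + x i * P ?d"
  proof -
    have "V - {j} = insert i W" using W by auto
    then show ?thesis using W by (simp add: taylor_def setpoly_insert P_def insert_commute)
  qed
  have tij: "taylor V c x {i, j} = P ?d"
    by (simp add: taylor_def W_def[symmetric] P_def)
  have "P ?a * P ?d \<le> P ?b * P ?g"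
  proof (rule ccontr)
    assume neg: "\<not> P ?a * P ?d \<le> P ?b * P ?g"
    define z0 where "z0 = (\<lambda>e k. complex_of_real (x k) + \<i> * of_real e)"
    define Q where "Q = (\<lambda>d e. setpoly W d (z0 e))"
    have Qlim: "(Q d \<longlongrightarrow> of_real (P d)) (at_right 0)" for d
    proof -
      have "(Q d \<longlongrightarrow> setpoly W d (z0 0)) (at_right 0)"
        unfolding Q_def setpoly_def z0_def by (intro tendsto_intros)
      then show ?thesis by (simp add: z0_def setpoly_of_real P_def)
    qed
    define N where "N = (\<lambda>e. Q ?a e + \<i> * Q ?b e)"
    define M where "M = (\<lambda>e. Q ?g e + \<i> * Q ?d e)"
    define N0 M0 where "N0 = complex_of_real (P ?a) + \<i> * of_real (P ?b)"
      and "M0 = complex_of_real (P ?g) + \<i> * of_real (P ?d)"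
    have lims: "(N \<longlongrightarrow> N0) (at_right 0)" "(M \<longlongrightarrow> M0) (at_right 0)"
      unfolding N_def M_def N0_def M0_def by (intro tendsto_intros Qlim)+
    have "P ?g \<noteq> 0 \<or> P ?d \<noteq> 0" using neg by auto
    then have M0: "M0 \<noteq> 0" by (auto simp: M0_def complex_eq_iff)
    have pos: "0 < (P ?g)\<^sup>2 + (P ?d)\<^sup>2"
      using \<open>P ?g \<noteq> 0 \<or> P ?d \<noteq> 0\<close> by (auto simp: sum_power2_gt_zero_iff)
    have "Im (- (N0 / M0)) = (P ?a * P ?d - P ?b * P ?g) / ((P ?g)\<^sup>2 + (P ?d)\<^sup>2)"
      by (simp add: N0_def M0_def Im_divide diff_divide_distrib)
    then have "0 < Im (- (N0 / M0))" using neg pos by simp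
    moreover have "((\<lambda>e. Im (- (N e / M e))) \<longlongrightarrow> Im (- (N0 / M0))) (at_right 0)"
      by (intro tendsto_intros lims M0)
    ultimately have "\<forall>\<^sub>F e in at_right 0. 0 < Im (- (N e / M e))"
      by (rule order_tendstoD(1)[rotated])
    moreover have "\<forall>\<^sub>F e in at_right 0. M e \<noteq> 0"
      using lims(2) M0 by (rule tendsto_imp_eventually_ne)
    moreover have "\<forall>\<^sub>F e::real in at_right 0. 0 < e"
      by (simp add: eventually_at_right_less)
    ultimately have "\<forall>\<^sub>F e in at_right 0. 0 < Im (- (N e / M e)) \<and> M e \<noteq> 0 \<and> 0 < e"
      by eventually_elim auto
    then obtain e where e: "0 < Im (- (N e / M e))" "M e \<noteq> 0" "0 < e"
      using eventually_happens'[OF trivial_limit_at_right_real] by blast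
    define z where "z = (z0 e)(i := \<i>, j := - (N e / M e))"
    have zW: "setpoly W d z = Q d e" for d
      unfolding Q_def z_def using W by (intro setpoly_cong) auto
    have zi: "z i = \<i>" "z j = - (N e / M e)" using ij by (auto simp: z_def)
    have "setpoly V c z = N e + z j * M e"
      unfolding expand zW zi(1) N_def M_def by (simp add: algebra_simps)
    also have "\<dots> = 0" using e(2) by (simp add: zi)
    finally have "setpoly V c z = 0" .
    moreover have "0 < Im (z k)" if "k \<in> V" for k
      using that e ij by (auto simp: z_def z0_def)
    ultimately show False using stable by blast
  qed
  then show "taylor V c x {} * taylor V c x {i, j} \<le> taylor V c x {i} * taylor V c x {j}"
    unfolding t0 ti tj tij by (simp add: algebra_simps)
qed

section \<open>The Grace--Walsh--Szego theorem for the upper half-plane\<close>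

lemma poly_pderiv_prod_linear:
  fixes r :: "nat \<Rightarrow> complex"
  assumes "\<And>k. k < n \<Longrightarrow> z \<noteq> r k"
  shows "poly (pderiv (\<Prod>k<n. [:- r k, 1:])) z
    = poly (\<Prod>k<n. [:- r k, 1:]) z * (\<Sum>k<n. 1 / (z - r k))"
  using assms
proof (induction n)
  case (Suc n)
  have "z - r n \<noteq> 0" using Suc.prems[of n] by simp
  let ?P = "\<Prod>k<n. [:- r k, 1:]" and ?s = "\<Sum>k<n. 1 / (z - r k)"
  have "poly (pderiv (?P * [:- r n, 1:])) z = poly ?P z + (z - r n) * poly (pderiv ?P) z"
    by (simp only: pderiv_mult poly_add poly_mult) (simp add: pderiv_pCons)
  also have "poly (pderiv ?P) z = poly ?P z * ?s" using Suc by simp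
  also have "poly ?P z + (z - r n) * (poly ?P z * ?s)
      = (poly ?P z * (z - r n)) * (?s + 1 / (z - r n))"
    using \<open>z - r n \<noteq> 0\<close> by (simp add: distrib_left mult.assoc)
  finally show ?case
    by (simp only: prod.lessThan_Suc sum.lessThan_Suc poly_mult) simp
qed (simp add: pderiv_1)

text \<open>
  Inversion maps the half-plane \<open>{w. Im w \<ge> h}\<close> onto a closed disc without its boundary point 0. The lemma serves
  to average the numbers \<open>1 / (z - r)\<close> over the roots \<open>r\<close> of a stable polynomial: discs are convex.
\<close>

lemma inverse_in_disc_iff:
  fixes u :: complex
  assumes "0 < h" "u \<noteq> 0"
  shows "cmod (u + \<i> / (2 * of_real h)) \<le> 1 / (2 * h) \<longleftrightarrow> h \<le> Im (inverse u)"
proof -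
  have "cmod (u + \<i> / (2 * of_real h)) \<le> 1 / (2 * h)
      \<longleftrightarrow> (cmod (u + \<i> / (2 * of_real h)))\<^sup>2 \<le> (1 / (2 * h))\<^sup>2"
    using assms(1) by (intro power_mono_iff[symmetric]) auto
  also have "(cmod (u + \<i> / (2 * of_real h)))\<^sup>2 = (cmod u)\<^sup>2 + Im u / h + (1 / (2 * h))\<^sup>2"
  proof -
    have "\<i> / (2 * of_real h) = Complex 0 (1 / (2 * h))"
      by (simp add: complex_eq_iff Im_divide power2_eq_square)
    then have "(cmod (u + \<i> / (2 * of_real h)))\<^sup>2 = (Re u)\<^sup>2 + (Im u + 1 / (2 * h))\<^sup>2"
      by (simp only: cmod_power2) simp
    then show ?thesis using assms(1) by (simp add: cmod_power2 power2_sum)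
  qed
  also have "\<dots> \<le> (1 / (2 * h))\<^sup>2 \<longleftrightarrow> h * (cmod u)\<^sup>2 + Im u \<le> 0"
  proof -
    have "(cmod u)\<^sup>2 + Im u / h = (h * (cmod u)\<^sup>2 + Im u) / h"
      using assms(1) by (simp add: add_divide_distrib)
    then show ?thesis using assms(1) by (simp add: divide_le_0_iff)
  qed
  also have "\<dots> \<longleftrightarrow> h \<le> Im (inverse u)"
  proof -
    have c: "0 < (cmod u)\<^sup>2" using assms(2) by simp
    have "Im (inverse u) = - Im u / (cmod u)\<^sup>2" by (simp add: cmod_power2)
    then have "h - Im (inverse u) = (h * (cmod u)\<^sup>2 + Im u) / (cmod u)\<^sup>2"
      using c by (simp add: field_simps)
    moreover have "h \<le> Im (inverse u) \<longleftrightarrow> h - Im (inverse u) \<le> 0" by linarith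
    ultimately show ?thesis using c by (simp add: divide_le_0_iff)
  qed
  finally show ?thesis .
qed

text \<open>
  The polar derivative of a polynomial of degree at most \<open>d\<close> with respect to the pole \<open>\<zeta>\<close>,
  scaled by \<open>1 / d\<close>. It is the polarisation of \<open>p\<close> with one argument set to \<open>\<zeta>\<close>
  and the others identified.
\<close>

definition polar :: "nat \<Rightarrow> complex \<Rightarrow> complex poly \<Rightarrow> complex poly" where
  "polar d \<zeta> p = p + smult (1 / of_nat d) ([:\<zeta>, -1:] * pderiv p)"

lemma coeff_polar:
  "coeff (polar d \<zeta> p) a
    = coeff p a + (\<zeta> * of_nat (Suc a) * coeff p (Suc a) - of_nat a * coeff p a) / of_nat d"
  by (cases a) (simp_all add: polar_def coeff_pderiv algebra_simps add_divide_distrib diff_divide_distrib)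

text \<open>
  Laguerre's theorem. A zero \<open>z\<close> in the upper half-plane of the polar derivative satisfies
  \<open>1 / (z - \<zeta>) = (1 / d) * (\<Sum>\<^sub>k 1 / (z - r\<^sub>k))\<close>, the sum running over the roots \<open>r\<^sub>k\<close> of \<open>p\<close>. These have \<open>Im r\<^sub>k \<le> 0\<close>,
  so each summand lies in the disc of the previous lemma with \<open>h = Im z\<close>, as does 0. The mean of the
  summands, padded with zeros to \<open>d\<close> terms, is in that disc, and so \<open>Im \<zeta> \<le> 0\<close>.
\<close>

lemma laguerre:
  assumes deg: "degree p \<le> d" and d: "0 < d"
    and nz: "\<And>z. 0 < Im z \<Longrightarrow> poly p z \<noteq> 0" and \<zeta>: "0 < Im \<zeta>" and z: "0 < Im z"
  shows "poly (polar d \<zeta> p) z \<noteq> 0"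
proof
  assume zero: "poly (polar d \<zeta> p) z = 0"
  obtain r where r: "smult (lead_coeff p) (\<Prod>k<degree p. [:- r k, 1:]) = p"
    using complex_poly_decompose'[of p] by blast
  let ?n = "degree p" and ?h = "Im z"
  have root: "poly p (r k) = 0" if "k < ?n" for k
  proof -
    have "poly (smult (lead_coeff p) (\<Prod>k<degree p. [:- r k, 1:])) (r k) = 0"
      using that by (auto simp: poly_prod)
    then show ?thesis unfolding r .
  qed
  have rIm: "Im (r k) \<le> 0" if "k < ?n" for k using root[OF that] nz[of "r k"] by force
  have zr: "z \<noteq> r k" if "k < ?n" for k using rIm[OF that] z by auto
  define s where "s = (\<Sum>k<?n. 1 / (z - r k))"
  have "poly (pderiv p) z = poly p z * s"
  proof -
    have "pderiv p = smult (lead_coeff p) (pderiv (\<Prod>k<degree p. [:- r k, 1:]))"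
      by (subst (1) r[symmetric]) (simp add: pderiv_smult)
    then have "poly (pderiv p) z
        = lead_coeff p * (poly (\<Prod>k<degree p. [:- r k, 1:]) z * s)"
      using poly_pderiv_prod_linear[of ?n z r] zr by (simp add: s_def)
    also have "\<dots> = poly (smult (lead_coeff p) (\<Prod>k<degree p. [:- r k, 1:])) z * s" by simp
    finally show ?thesis unfolding r .
  qed
  then have "poly p z * (1 + (\<zeta> - z) * (s / of_nat d)) = 0"
    using zero by (simp add: polar_def algebra_simps diff_divide_distrib)
  then have v: "1 + (\<zeta> - z) * (s / of_nat d) = 0" using nz[OF z] by simp
  let ?w = "\<i> / (2 * of_real ?h)"
  have "cmod (s + of_nat d * ?w) \<le> d * (1 / (2 * ?h))"
  proof -
    have "s + of_nat d * ?w = (\<Sum>k<?n. 1 / (z - r k) + ?w) + of_nat (d - ?n) * ?w"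
      using deg by (simp add: s_def sum.distrib of_nat_diff algebra_simps diff_divide_distrib)
    also have "cmod \<dots> \<le> (\<Sum>k<?n. cmod (1 / (z - r k) + ?w)) + cmod (of_nat (d - ?n) * ?w)"
      by (intro order_trans[OF norm_triangle_ineq] add_mono norm_sum order_refl)
    also have "\<dots> \<le> (\<Sum>k<?n. 1 / (2 * ?h)) + of_nat (d - ?n) * (1 / (2 * ?h))"
    proof (intro add_mono sum_mono)
      fix k assume "k \<in> {..<?n}"
      then show "cmod (1 / (z - r k) + ?w) \<le> 1 / (2 * ?h)"
        using inverse_in_disc_iff[of ?h "1 / (z - r k)"] z zr[of k] rIm[of k] by simp
    next
      show "cmod (of_nat (d - ?n) * ?w) \<le> of_nat (d - ?n) * (1 / (2 * ?h))"
        using z by (simp add: norm_mult norm_divide)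
    qed
    also have "\<dots> = d * (1 / (2 * ?h))" using deg by (simp add: of_nat_diff algebra_simps diff_divide_distrib)
    finally show ?thesis .
  qed
  moreover have "s + of_nat d * ?w = of_nat d * (s / of_nat d + ?w)" using d by (simp add: algebra_simps)
  ultimately have "real d * cmod (s / of_nat d + ?w) \<le> real d * (1 / (2 * ?h))"
    by (simp only: norm_mult norm_of_nat)
  then have disc: "cmod (s / of_nat d + ?w) \<le> 1 / (2 * ?h)"
    using d by (simp only: mult_le_cancel_left_pos of_nat_0_less_iff)
  have "s / of_nat d \<noteq> 0" using v d by auto
  then have "?h \<le> Im (inverse (s / of_nat d))"
    using inverse_in_disc_iff[of ?h "s / of_nat d"] z disc by simp
  moreover have "inverse (s / of_nat d) = z - \<zeta>"
  proof (rule inverse_unique)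
    have "q * (z - \<zeta>) = 1" if "1 + (\<zeta> - z) * q = 0" for q using that by algebra
    then show "s / of_nat d * (z - \<zeta>) = 1" using v by blast
  qed
  ultimately show False using \<zeta> by simp
qed

lemma degree_polar:
  assumes "degree p \<le> Suc d"
  shows "degree (polar (Suc d) \<zeta> p) \<le> d"
proof (rule degree_le, intro allI impI)
  fix a assume a: "d < a"
  then have "coeff p (Suc a) = 0" using assms by (intro coeff_eq_0) simp
  moreover have "coeff p a = 0 \<or> a = Suc d" using a assms by (metis Suc_lessI coeff_eq_0 le_less_trans)
  ultimately show "coeff (polar (Suc d) \<zeta> p) a = 0"
    unfolding coeff_polar by (auto simp del: of_nat_Suc)
qed

text \<open>
  Setting the last argument of the polarisation of \<open>p\<close> to \<open>z d\<close> gives the polarisation, in one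
  variable less, of the polar derivative of \<open>p\<close> with pole \<open>z d\<close>, which is stable by Laguerre's
  theorem.
\<close>

theorem grace_walsh_szego:
  assumes "degree p \<le> d" "\<And>z. 0 < Im z \<Longrightarrow> poly p z \<noteq> 0" "\<And>k. k < d \<Longrightarrow> 0 < Im (z k)"
  shows "(\<Sum>S\<in>Pow {..<d}. coeff p (card S) / of_nat (d choose card S) * (\<Prod>k\<in>S. z k)) \<noteq> 0"
  using assms
proof (induction d arbitrary: p)
  case 0
  then have "p = [:coeff p 0:]" by (metis degree_0_id le_zero_eq)
  then have "poly p \<i> = coeff p 0" by (metis mult_zero_right poly_0 poly_pCons add.right_neutral)
  then show ?case using 0(2)[of \<i>] by simp
next
  case (Suc d)
  let ?q = "polar (Suc d) (z d) p"
  have cq: "coeff ?q a / of_nat (d choose a) = coeff p a / of_nat (Suc d choose a)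
      + z d * (coeff p (Suc a) / of_nat (Suc d choose Suc a))" if a: "a \<le> d" for a
  proof -
    have p: "of_nat (d choose a) \<noteq> (0::complex)" using a by simp
    have 1: "of_nat (Suc d choose Suc a) * of_nat (Suc a) = (of_nat (Suc d) * of_nat (d choose a) :: complex)"
      by (metis Suc_times_binomial_eq mult.commute of_nat_mult)
    have "(Suc d - a) * (Suc d choose a) = Suc d * (d choose a)"
      using binomial_absorb_comp[of "Suc d" a] by simp
    then have "of_nat (Suc d - a) * of_nat (Suc d choose a) = (of_nat (Suc d) * of_nat (d choose a) :: complex)"
      by (metis of_nat_mult)
    then have 2: "(of_nat (Suc d) - of_nat a) * of_nat (Suc d choose a) = (of_nat (Suc d) * of_nat (d choose a) :: complex)"
      using a by (simp add: of_nat_diff)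
    have nzd: "of_nat (Suc d choose a) \<noteq> (0::complex)" "of_nat (Suc d choose Suc a) \<noteq> (0::complex)"
      "of_nat (Suc d) \<noteq> (0::complex)"
      using a by (simp_all del: binomial_Suc_Suc of_nat_Suc)
    have "coeff ?q a = coeff p a * (of_nat (Suc d) - of_nat a) / of_nat (Suc d)
        + z d * coeff p (Suc a) * (of_nat (Suc a) / of_nat (Suc d))"
      unfolding coeff_polar using nzd(3) by (simp add: field_simps del: of_nat_Suc)
    moreover have "(of_nat (Suc d) - of_nat a) / of_nat (Suc d)
        = (of_nat (d choose a) / of_nat (Suc d choose a) :: complex)"
      using 2 nzd by (simp add: field_simps del: of_nat_Suc binomial_Suc_Suc)
    moreover have "of_nat (Suc a) / of_nat (Suc d)
        = (of_nat (d choose a) / of_nat (Suc d choose Suc a) :: complex)"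
      using 1 nzd by (simp add: field_simps del: of_nat_Suc binomial_Suc_Suc)
    ultimately have "coeff ?q a = coeff p a * (of_nat (d choose a) / of_nat (Suc d choose a))
        + z d * coeff p (Suc a) * (of_nat (d choose a) / of_nat (Suc d choose Suc a))"
      by (metis times_divide_eq_right)
    then show ?thesis using p by (simp add: add_divide_distrib del: of_nat_Suc binomial_Suc_Suc)
  qed
  let ?f = "\<lambda>S. coeff p (card S) / of_nat (Suc d choose card S) * (\<Prod>k\<in>S. z k)"
  have "(\<Sum>S\<in>Pow {..<Suc d}. ?f S) = (\<Sum>S\<in>Pow {..<d}. ?f S) + (\<Sum>S\<in>insert d ` Pow {..<d}. ?f S)"
    unfolding lessThan_Suc Pow_insert by (intro sum.union_disjoint) auto
  also have "(\<Sum>S\<in>insert d ` Pow {..<d}. ?f S) = (\<Sum>S\<in>Pow {..<d}. ?f (insert d S))"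
    by (subst sum.reindex) (auto simp: inj_on_def)
  also have "(\<Sum>S\<in>Pow {..<d}. ?f S) + \<dots> = (\<Sum>S\<in>Pow {..<d}. ?f S + ?f (insert d S))"
    by (simp add: sum.distrib)
  also have "\<dots> = (\<Sum>S\<in>Pow {..<d}. coeff ?q (card S) / of_nat (d choose card S) * (\<Prod>k\<in>S. z k))"
  proof (rule sum.cong[OF refl])
    fix S assume S: "S \<in> Pow {..<d}"
    then have fS: "finite S" "d \<notin> S" by (auto intro: finite_subset)
    have cS: "card S \<le> d" using S card_mono[of "{..<d}" S] by simp
    show "?f S + ?f (insert d S) = coeff ?q (card S) / of_nat (d choose card S) * (\<Prod>k\<in>S. z k)"
      unfolding cq[OF cS] using fS by (simp add: algebra_simps del: binomial_Suc_Suc)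
  qed
  also have "\<dots> \<noteq> 0"
  proof (rule Suc.IH)
    show "degree ?q \<le> d" using Suc.prems(1) by (rule degree_polar)
    show "poly ?q w \<noteq> 0" if "0 < Im w" for w
      using Suc.prems that by (intro laguerre) auto
  qed (use Suc.prems(3) in auto)
  finally show ?case .
qed

section \<open>Coefficients of multi-affine polynomials\<close>

definition squarefree_monom :: "nat set \<Rightarrow> monom" where
  "squarefree_monom S = (\<Sum>i\<in>S. Poly_Mapping.single i 1)"

lemma lookup_squarefree_monom:
  assumes "finite S"
  shows "Poly_Mapping.lookup (squarefree_monom S) i = (if i \<in> S then 1 else 0)"
  using assms by (simp add: squarefree_monom_def lookup_sum lookup_single when_def)

lemma keys_squarefree_monom:
  assumes "finite S"
  shows "Poly_Mapping.keys (squarefree_monom S) = S"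
  by (auto simp: in_keys_iff lookup_squarefree_monom[OF assms] split: if_splits)

lemma inj_on_squarefree_monom: "inj_on squarefree_monom (Pow {..<m})"
proof (rule inj_onI)
  fix S T assume "S \<in> Pow {..<m}" "T \<in> Pow {..<m}" "squarefree_monom S = squarefree_monom T"
  then show "S = T" using keys_squarefree_monom[of S] keys_squarefree_monom[of T]
    by (metis PowD finite_lessThan finite_subset)
qed

lemma multi_affine_keys:
  assumes "g \<in> polys m" "multi_affine g"
  shows "Poly_Mapping.keys g \<subseteq> squarefree_monom ` Pow {..<m}"
proof
  fix k assume k: "k \<in> Poly_Mapping.keys g"
  have K: "Poly_Mapping.keys k \<subseteq> {..<m}" using assms(1) k by (auto simp: polys_def)
  have "k = squarefree_monom (Poly_Mapping.keys k)"
  proof (rule poly_mapping_eqI)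
    fix i
    have "Poly_Mapping.lookup k i \<le> 1" using assms(2) k by (auto simp: multi_affine_def)
    then show "Poly_Mapping.lookup k i = Poly_Mapping.lookup (squarefree_monom (Poly_Mapping.keys k)) i"
      by (auto simp: lookup_squarefree_monom in_keys_iff)
  qed
  then show "k \<in> squarefree_monom ` Pow {..<m}" using K by auto
qed

lemma eval_multi_affine:
  assumes "g \<in> polys m" "multi_affine g"
  shows "eval_poly g x = setpoly {..<m} (\<lambda>S. Poly_Mapping.lookup g (squarefree_monom S)) x"
proof -
  let ?t = "\<lambda>k. of_real (Poly_Mapping.lookup g k)
    * (\<Prod>i\<in>Poly_Mapping.keys k. x i ^ Poly_Mapping.lookup k i)"
  have "eval_poly g x = (\<Sum>k\<in>squarefree_monom ` Pow {..<m}. ?t k)"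
    unfolding eval_poly_def using multi_affine_keys[OF assms]
    by (intro sum.mono_neutral_left) (auto simp: in_keys_iff)
  also have "\<dots> = (\<Sum>S\<in>Pow {..<m}. ?t (squarefree_monom S))"
    by (simp add: sum.reindex[OF inj_on_squarefree_monom])
  also have "\<dots> = (\<Sum>S\<in>Pow {..<m}. of_real (Poly_Mapping.lookup g (squarefree_monom S)) * (\<Prod>i\<in>S. x i))"
  proof (rule sum.cong[OF refl])
    fix S assume "S \<in> Pow {..<m}"
    then have f: "finite S" by (auto intro: finite_subset)
    show "?t (squarefree_monom S) = of_real (Poly_Mapping.lookup g (squarefree_monom S)) * (\<Prod>i\<in>S. x i)"
      by (simp add: keys_squarefree_monom[OF f] lookup_squarefree_monom[OF f])
  qed
  finally show ?thesis by (simp add: setpoly_def)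
qed

definition multi_affine_poly :: "nat \<Rightarrow> (nat set \<Rightarrow> real) \<Rightarrow> rpoly" where
  "multi_affine_poly m c = (\<Sum>S\<in>Pow {..<m}. Poly_Mapping.single (squarefree_monom S) (c S))"

lemma lookup_multi_affine_poly:
  assumes "S \<subseteq> {..<m}"
  shows "Poly_Mapping.lookup (multi_affine_poly m c) (squarefree_monom S) = c S"
proof -
  have "Poly_Mapping.lookup (multi_affine_poly m c) (squarefree_monom S)
      = (\<Sum>T\<in>Pow {..<m}. if T = S then c T else 0)"
    unfolding multi_affine_poly_def lookup_sum lookup_single
  proof (intro sum.cong refl)
    fix T assume "T \<in> Pow {..<m}"
    then show "(c T when squarefree_monom T = squarefree_monom S) = (if T = S then c T else 0)"
      using inj_onD[OF inj_on_squarefree_monom, of T S m] assms by (auto simp: when_def)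
  qed
  then show ?thesis using assms by simp
qed

lemma multi_affine_poly:
  shows "multi_affine_poly m c \<in> polys m" "multi_affine (multi_affine_poly m c)"
    and eval_multi_affine_poly: "eval_poly (multi_affine_poly m c) x = setpoly {..<m} c x"
proof -
  have K: "\<exists>S\<subseteq>{..<m}. k = squarefree_monom S"
    if k: "k \<in> Poly_Mapping.keys (multi_affine_poly m c)" for k
  proof (rule ccontr)
    assume "\<not> ?thesis"
    then have "Poly_Mapping.lookup (multi_affine_poly m c) k = 0"
      unfolding multi_affine_poly_def lookup_sum lookup_single
      by (intro sum.neutral) (auto simp: when_def)
    then show False using k by (simp add: in_keys_iff)
  qed
  have fin: "finite S" if "S \<subseteq> {..<m}" for S using that by (auto intro: finite_subset)
  show 1: "multi_affine_poly m c \<in> polys m"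
    unfolding polys_def using K keys_squarefree_monom[OF fin] by fastforce
  show 2: "multi_affine (multi_affine_poly m c)"
    unfolding multi_affine_def using K lookup_squarefree_monom[OF fin] by fastforce
  show "eval_poly (multi_affine_poly m c) x = setpoly {..<m} c x"
    unfolding eval_multi_affine[OF 1 2]
    by (intro setpoly_cong lookup_multi_affine_poly) auto
qed

lemma eval_polys:
  assumes "f \<in> polys n"
  shows "eval_poly f x = (\<Sum>k\<in>Poly_Mapping.keys f. of_real (Poly_Mapping.lookup f k)
      * (\<Prod>i<n. x i ^ Poly_Mapping.lookup k i))"
  unfolding eval_poly_def
proof (intro sum.cong refl arg_cong2[of _ _ _ _ "(*)"])
  fix k assume "k \<in> Poly_Mapping.keys f"
  then show "(\<Prod>i\<in>Poly_Mapping.keys k. x i ^ Poly_Mapping.lookup k i)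
      = (\<Prod>i<n. x i ^ Poly_Mapping.lookup k i)"
    using assms by (intro prod.mono_neutral_left) (auto simp: polys_def in_keys_iff)
qed

section \<open>Components that pass the positive ray test\<close>

lemma Euclidean_space_top_of_set: "Euclidean_space n = top_of_set {x. \<forall>i\<ge>n. x i = 0}"
  by (simp add: Euclidean_space_def euclidean_product_topology)

lemma continuous_on_line: "continuous_on A (\<lambda>t i. x i + t * (y i :: real))"
  by (intro continuous_on_coordinatewise_then_product continuous_intros)

text \<open>
  This makes the positive ray test a statement about nonnegative translation vectors.
\<close>

lemma closure_pos_orthant:
  "Euclidean_space n closure_of pos_orthant n = {y. (\<forall>i\<ge>n. y i = 0) \<and> (\<forall>i. 0 \<le> y i)}"
proof -
  let ?E = "{x :: nat \<Rightarrow> real. \<forall>i\<ge>n. x i = 0}"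
  have eq: "Euclidean_space n closure_of pos_orthant n = ?E \<inter> closure (pos_orthant n)"
  proof -
    have "pos_orthant n \<subseteq> ?E" by (auto simp: pos_orthant_def topspace_Euclidean_space)
    then show ?thesis
      unfolding Euclidean_space_top_of_set by (simp add: closure_of_subtopology Int_absorb1)
  qed
  have sub: "closure (pos_orthant n) \<subseteq> {y. \<forall>i. 0 \<le> y i}"
  proof (rule closure_minimal)
    show "pos_orthant n \<subseteq> {y. \<forall>i. 0 \<le> y i}"
      by (auto simp: pos_orthant_def topspace_Euclidean_space) (metis less_imp_le linorder_not_le order_refl)
    show "closed {y :: nat \<Rightarrow> real. \<forall>i. 0 \<le> y i}"
      by (intro closed_Collect_all closed_Collect_le continuous_on_const continuous_on_product_coordinates)
  qed
  have sup: "y \<in> closure (pos_orthant n)" if y: "\<forall>i\<ge>n. y i = 0" "\<forall>i. 0 \<le> y i" for y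
  proof -
    let ?f = "\<lambda>t i. y i + t * (if i < n then 1 else (0::real))"
    have "isCont ?f 0" using continuous_on_line[of UNIV y "\<lambda>i. if i < n then 1 else 0"]
      by (simp add: continuous_on_eq_continuous_at)
    then have lim: "(?f \<longlongrightarrow> y) (at_right 0)"
      unfolding isCont_def by (auto intro: tendsto_mono[OF at_le])
    have ev: "\<forall>\<^sub>F t in at_right 0. ?f t \<in> closure (pos_orthant n)"
      using eventually_at_right_less[of "0::real"]
    proof eventually_elim
      case (elim t)
      then have "?f t \<in> pos_orthant n"
        using y by (auto simp: pos_orthant_def topspace_Euclidean_space add_nonneg_pos)
      then show ?case using closure_subset by blast
    qed
    show ?thesis by (rule Lim_in_closed_set[OF closed_closure ev _ lim]) simp
  qed
  show ?thesis unfolding eq using sub sup by auto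
qed

lemma PRT_iff:
  "PRT n R \<longleftrightarrow> (\<forall>x\<in>R. \<forall>y. (\<forall>i\<ge>n. y i = 0) \<longrightarrow> (\<forall>i. 0 \<le> y i) \<longrightarrow> (\<lambda>i. x i + y i) \<in> R)"
  unfolding PRT_def closure_pos_orthant by auto

lemma PRT_ge:
  assumes "PRT n R" "x \<in> R" "\<And>i. n \<le> i \<Longrightarrow> x i = 0 \<and> y i = 0" "\<And>i. i < n \<Longrightarrow> x i \<le> y i"
  shows "y \<in> R"
proof -
  have "(\<lambda>i. x i + (y i - x i)) \<in> R"
  proof -
    have "0 \<le> y i - x i" for i using assms(3,4)[of i] by (cases "i < n") auto
    then show ?thesis
      using assms(1)[unfolded PRT_iff, rule_format, OF assms(2), of "\<lambda>i. y i - x i"] assms(3)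
      by simp
  qed
  then show ?thesis by simp
qed

lemma connected_component_of_segment:
  assumes "P \<subseteq> topspace (Euclidean_space n)"
    and "\<And>t. 0 \<le> t \<Longrightarrow> t \<le> 1 \<Longrightarrow> (\<lambda>i. x i + t * (y i - x i)) \<in> P"
  shows "connected_component_of (subtopology (Euclidean_space n) P) x y"
proof -
  let ?f = "\<lambda>t i. x i + t * (y i - x i)"
  let ?T = "?f ` {0..1}"
  have "connected ?T"
    by (intro connected_continuous_image continuous_on_line) simp
  moreover have "?T \<subseteq> P" using assms(2) by auto
  ultimately have "connectedin (subtopology (Euclidean_space n) P) ?T"
    using assms(1) by (auto simp: connectedin_subtopology Euclidean_space_top_of_set)
  moreover have "?f 0 \<in> ?T" "?f 1 \<in> ?T" by (rule imageI, simp)+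
  then have "x \<in> ?T" "y \<in> ?T" by simp_all
  ultimately show ?thesis by (auto simp: connected_component_of_def)
qed

lemma pos_set_subset: "pos_set n f \<subseteq> topspace (Euclidean_space n)"
  by (auto simp: pos_set_def)

lemma PRT_component_subset:
  assumes "PRT_component n f C"
  shows "C \<subseteq> pos_set n f"
  using assms connected_components_of_subset[of C] by (fastforce simp: PRT_component_def)

lemma PRT_component_nonempty:
  assumes "PRT_component n f C"
  shows "C \<noteq> {}"
  using assms nonempty_connected_components_of by (auto simp: PRT_component_def)

lemma PRT_component_segment:
  assumes "PRT_component n f C" "x \<in> C" "\<And>i. n \<le> i \<Longrightarrow> y i = 0"
    and "\<And>t. 0 \<le> t \<Longrightarrow> t \<le> 1 \<Longrightarrow> 0 < eval_poly f (\<lambda>i. x i + t * (y i - x i))"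
  shows "y \<in> C"
proof -
  let ?X = "subtopology (Euclidean_space n) (pos_set n f)"
  obtain z where z: "C = connected_component_of_set ?X z"
    using assms(1) by (auto simp: PRT_component_def connected_components_of_def)
  have x0: "x i = 0" if "n \<le> i" for i
    using PRT_component_subset[OF assms(1)] assms(2) that
    by (auto simp: pos_set_def topspace_Euclidean_space)
  have "connected_component_of ?X x y"
  proof (rule connected_component_of_segment[OF pos_set_subset])
    fix t :: real assume "0 \<le> t" "t \<le> 1"
    then show "(\<lambda>i. x i + t * (y i - x i)) \<in> pos_set n f"
      using x0 assms(3,4) by (simp add: pos_set_def topspace_Euclidean_space)
  qed
  moreover have "connected_component_of ?X z x" using assms(2) z by simp
  ultimately have "connected_component_of ?X z y" by (rule connected_component_of_trans[rotated])
  then show ?thesis by (simp add: z)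
qed

text \<open>
  Two sets that pass the positive ray test meet in the componentwise maximum of any two of their
  points.
\<close>

lemma PRT_component_unique:
  assumes "PRT_component n f C" "PRT_component n f C'"
  shows "C = C'"
proof -
  obtain x y where xy: "x \<in> C" "y \<in> C'" using assms PRT_component_nonempty by blast
  have E: "x i = 0" "y i = 0" if "n \<le> i" for i
    using xy PRT_component_subset[OF assms(1)] PRT_component_subset[OF assms(2)] that
    by (auto simp: pos_set_def topspace_Euclidean_space)
  have P: "PRT n C" "PRT n C'" using assms by (auto simp: PRT_component_def)
  have "(\<lambda>i. max (x i) (y i)) \<in> C"
    by (rule PRT_ge[OF P(1) xy(1)]) (simp_all add: E)
  moreover have "(\<lambda>i. max (x i) (y i)) \<in> C'"
    by (rule PRT_ge[OF P(2) xy(2)]) (simp_all add: E)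
  ultimately have "C \<inter> C' \<noteq> {}" by blast
  then show ?thesis using assms connected_components_of_overlap by (metis PRT_component_def)
qed

lemma garding_component_nonempty_iff:
  "garding_component n f \<noteq> {} \<longleftrightarrow> f = 0 \<or> (\<exists>C. PRT_component n f C)"
proof (cases "f = 0")
  case True
  have "(\<lambda>_. 0) \<in> topspace (Euclidean_space n)" by (simp add: topspace_Euclidean_space)
  then show ?thesis using True by (auto simp: garding_component_def)
next
  case False
  show ?thesis
  proof (cases "\<exists>C. PRT_component n f C")
    case True
    then obtain C where C: "PRT_component n f C" by blast
    have u: "C' = C" if "PRT_component n f C'" for C'
      using that C by (rule PRT_component_unique)
    have "\<exists>!C. PRT_component n f C" using C u by (rule ex1I)
    moreover have "(THE C. PRT_component n f C) = C" using C u by (rule the_equality)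
    ultimately have "garding_component n f = C" using False by (simp add: garding_component_def)
    then show ?thesis using True PRT_component_nonempty[OF C] by simp
  next
    case no: False
    then have "\<not> (\<exists>!C. PRT_component n f C)" by (meson ex1_implies_ex)
    then have "garding_component n f = {}" using False by (simp add: garding_component_def)
    then show ?thesis using no False by simp
  qed
qed

lemma continuous_on_setpoly: "continuous_on A (\<lambda>x. setpoly V c (x :: nat \<Rightarrow> real))"
proof -
  have "continuous_on A (\<lambda>x::nat \<Rightarrow> real. x i)" for i
    by (rule continuous_on_subset[OF continuous_on_product_coordinates]) auto
  then show ?thesis unfolding setpoly_def by (intro continuous_intros)
qed

text \<open>
  The witness is the set \<open>K\<close> of all points with positive value and nonnegative derivatives, which
  is the largest subset of \<open>{g > 0}\<close> that passes the positive ray test. It is closed in \<open>{g > 0}\<close>; the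
  assumption on the support makes it open there, because at a point of \<open>K\<close> the derivative
  at \<open>S\<close> either is positive or has all its Taylor coefficients equal to zero.
\<close>

lemma multi_affine_garding_criterion:
  assumes x0: "0 < taylor {..<m} c x0 {}" "\<And>S. S \<subseteq> {..<m} \<Longrightarrow> 0 \<le> taylor {..<m} c x0 S"
    and supp: "\<And>x S T. 0 < taylor {..<m} c x {} \<Longrightarrow>
      (\<And>S. S \<subseteq> {..<m} \<Longrightarrow> 0 \<le> taylor {..<m} c x S) \<Longrightarrow> S \<subseteq> T \<Longrightarrow> T \<subseteq> {..<m} \<Longrightarrow>
      0 < taylor {..<m} c x T \<Longrightarrow> 0 < taylor {..<m} c x S"
  shows "multi_affine_garding m (multi_affine_poly m c)"
proof -
  let ?V = "{..<m}" and ?g = "multi_affine_poly m c"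
  let ?t = "taylor ?V c"
  define K where "K = {x. (\<forall>i\<ge>m. x i = 0) \<and> 0 < ?t x {} \<and> (\<forall>S. S \<subseteq> ?V \<longrightarrow> 0 \<le> ?t x S)}"
  have pos_set: "pos_set m ?g = {x. (\<forall>i\<ge>m. x i = 0) \<and> 0 < ?t x {}}"
    by (simp add: pos_set_def topspace_Euclidean_space eval_multi_affine_poly taylor_empty)
  have cont: "continuous_on UNIV (\<lambda>x. ?t x S)" for S
    unfolding taylor_def by (rule continuous_on_setpoly)
  have KP: "K \<subseteq> pos_set m ?g" unfolding K_def pos_set by auto
  have PRT_K: "PRT m K"
    unfolding PRT_iff
  proof (intro ballI allI impI)
    fix x y :: "nat \<Rightarrow> real" assume x: "x \<in> K" and y: "\<forall>i\<ge>m. y i = 0" "\<forall>i. 0 \<le> y i"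
    have nn: "0 \<le> ?t x S" if "S \<subseteq> ?V" for S using x that by (auto simp: K_def)
    have "0 < ?t x {}" using x by (auto simp: K_def)
    also have "?t x {} = setpoly ?V (?t x) (\<lambda>_. 0)" by (simp add: setpoly_zero)
    also have "\<dots> \<le> setpoly ?V (?t x) y" using y nn by (intro setpoly_mono) auto
    also have "\<dots> = ?t (\<lambda>i. x i + y i) {}" by (simp add: taylor_empty setpoly_add)
    finally have "0 < ?t (\<lambda>i. x i + y i) {}" .
    moreover have "0 \<le> ?t (\<lambda>i. x i + y i) S" if S: "S \<subseteq> ?V" for S
    proof -
      have "?t (\<lambda>i. x i + y i) S = setpoly (?V - S) (\<lambda>T. ?t x (T \<union> S)) y"
        by (simp add: taylor_add taylor_def[of ?V "?t x"])
      also have "\<dots> \<ge> 0" using y S by (intro setpoly_nonneg nn) auto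
      finally show ?thesis .
    qed
    ultimately show "(\<lambda>i. x i + y i) \<in> K" using x y by (auto simp: K_def)
  qed
  define y0 where "y0 = (\<lambda>i. if i < m then x0 i else 0)"
  have "?t y0 S = ?t x0 S" for S
    unfolding taylor_def by (intro setpoly_cong) (auto simp: y0_def)
  then have y0: "y0 \<in> K" using x0 by (auto simp: K_def y0_def)
  let ?X = "subtopology (Euclidean_space m) (pos_set m ?g)"
  have "K \<subseteq> connected_component_of_set ?X y0"
  proof
    fix x assume x: "x \<in> K"
    \<comment> \<open>Both segments up to the maximum stay in \<open>K\<close> by the positive ray test.\<close>
    define z where "z = (\<lambda>i. max (x i) (y0 i))"
    have up: "connected_component_of ?X w z" if w: "w \<in> K" and le: "\<And>i. w i \<le> z i" for w
    proof (rule connected_component_of_segment[OF pos_set_subset])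
      fix t :: real assume t: "0 \<le> t" "t \<le> 1"
      have E: "w i = 0 \<and> z i = 0" if "m \<le> i" for i
        using w x y0 that by (auto simp: K_def z_def)
      have "(\<lambda>i. w i + t * (z i - w i)) \<in> K"
        using t le by (intro PRT_ge[OF PRT_K w]) (auto simp: E)
      then show "(\<lambda>i. w i + t * (z i - w i)) \<in> pos_set m ?g" using KP by auto
    qed
    have "connected_component_of ?X y0 z" "connected_component_of ?X x z"
      by (rule up[OF y0], simp add: z_def) (rule up[OF x], simp add: z_def)
    then show "x \<in> connected_component_of_set ?X y0"
      using connected_component_of_trans connected_component_of_sym by (metis mem_Collect_eq)
  qed
  moreover have "connected_component_of_set ?X y0 \<subseteq> K"
  proof
    fix x assume "x \<in> connected_component_of_set ?X y0"
    then obtain T where T: "connectedin ?X T" "y0 \<in> T" "x \<in> T"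
      by (auto simp: connected_component_of_def)
    then have cT: "connected T" and TP: "T \<subseteq> pos_set m ?g"
      by (auto simp: connectedin_subtopology Euclidean_space_top_of_set)
    \<comment> \<open>Two open sets that separate \<open>K\<close> from the rest of \<open>{g > 0}\<close>.\<close>
    define U where "U = (\<Union>w\<in>K. {z. \<forall>S\<in>{S \<in> Pow ?V. ?t w S \<noteq> 0}. 0 < ?t z S})"
    define W where "W = {z. \<exists>S\<in>Pow ?V. ?t z S < 0}"
    have opF: "open {z. \<forall>S\<in>F. 0 < ?t z S}" if "finite F" for F
    proof -
      have "{z. \<forall>S\<in>F. 0 < ?t z S} = (\<Inter>S\<in>F. {z. 0 < ?t z S})" by auto
      then show ?thesis
        using that by (auto intro!: open_INT open_Collect_less cont continuous_on_const)
    qed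
    have opU: "open U" unfolding U_def by (intro open_UN ballI opF) auto
    have opW: "open W"
    proof -
      have "W = (\<Union>S\<in>Pow ?V. {z. ?t z S < 0})" by (auto simp: W_def)
      then show ?thesis by (auto intro!: open_UN open_Collect_less cont continuous_on_const)
    qed
    have KU: "K \<subseteq> U"
    proof
      fix w assume w: "w \<in> K"
      then have "\<forall>S\<in>{S \<in> Pow ?V. ?t w S \<noteq> 0}. 0 < ?t w S" by (auto simp: K_def less_le)
      then show "w \<in> U" using w unfolding U_def by blast
    qed
    have UW: "U \<inter> W = {}"
    proof -
      have nn: "0 \<le> ?t z S" if w: "w \<in> K" and z: "\<forall>S\<in>{S \<in> Pow ?V. ?t w S \<noteq> 0}. 0 < ?t z S"
        and S: "S \<subseteq> ?V" for w z S
      proof (cases "?t w S = 0")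
        case True
        have zero: "?t w (T \<union> S) = 0" if "T \<subseteq> ?V - S" for T
        proof (rule ccontr)
          assume "?t w (T \<union> S) \<noteq> 0"
          moreover have TS: "T \<union> S \<subseteq> ?V" using that S by auto
          ultimately have "0 < ?t w (T \<union> S)" using w by (auto simp: K_def less_le)
          then have "0 < ?t w S" using w TS supp[of w S "T \<union> S"] by (auto simp: K_def)
          then show False using True by simp
        qed
        have "?t z S = ?t (\<lambda>i. w i + (z i - w i)) S" by simp
        also have "\<dots> = setpoly (?V - S) (\<lambda>T. ?t w (T \<union> S)) (\<lambda>i. z i - w i)"
          by (simp only: taylor_add finite_lessThan taylor_def[of ?V "?t w"])
        also have "\<dots> = 0" using zero by (simp add: setpoly_def)
        finally show ?thesis by simp
      next
        case False
        then show ?thesis using z S by (auto intro: less_imp_le)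
      qed
      show ?thesis
      proof (rule equals0I)
        fix z assume "z \<in> U \<inter> W"
        then obtain w S where w: "w \<in> K" "\<forall>S\<in>{S \<in> Pow ?V. ?t w S \<noteq> 0}. 0 < ?t z S"
          and S: "S \<subseteq> ?V" "?t z S < 0"
          unfolding U_def W_def by blast
        show False using nn[OF w S(1)] S(2) by simp
      qed
    qed
    have KW: "z \<in> K" if z: "z \<in> T" "z \<notin> W" for z
    proof -
      have "z \<in> pos_set m ?g" using TP z by blast
      then have "\<forall>i\<ge>m. z i = 0" "0 < ?t z {}" unfolding pos_set by auto
      moreover have "0 \<le> ?t z S" if "S \<subseteq> ?V" for S
        using z(2) that unfolding W_def by (auto simp: not_less)
      ultimately show ?thesis by (simp add: K_def)
    qed
    then have "T \<subseteq> U \<union> W" using KU by blast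
    moreover have "y0 \<in> U \<inter> T" using y0 KU T by blast
    ultimately have "W \<inter> T = {}"
      using connectedD[OF cT opU opW] UW by blast
    then have "x \<notin> W" using T by blast
    then show "x \<in> K" using T KW by blast
  qed
  ultimately have "connected_component_of_set ?X y0 = K" by auto
  moreover have "y0 \<in> topspace ?X" using y0 KP pos_set_subset by auto
  ultimately have "K \<in> connected_components_of ?X" by (auto simp: connected_components_of_def)
  then have "PRT_component m ?g K" using PRT_K by (simp add: PRT_component_def)
  then have "garding_component m ?g \<noteq> {}" using garding_component_nonempty_iff by blast
  then show ?thesis by (simp add: multi_affine_garding_def multi_affine_poly)
qed

lemma rayleigh_imp_garding:
  assumes "rayleigh {..<m} c" "positive_top {..<m} c"
  shows "multi_affine_garding m (multi_affine_poly m c)"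
proof -
  obtain s where s: "0 < taylor {..<m} c (\<lambda>_. s) {}"
      "\<And>S. S \<subseteq> {..<m} \<Longrightarrow> 0 \<le> taylor {..<m} c (\<lambda>_. s) S"
    using rayleigh_positive_point[OF _ assms] by auto
  show ?thesis
  proof (rule multi_affine_garding_criterion[OF s])
    fix x S T
    assume pos: "0 < taylor {..<m} c x {}" "\<And>S. S \<subseteq> {..<m} \<Longrightarrow> 0 \<le> taylor {..<m} c x S"
      and ST: "S \<subseteq> T" "T \<subseteq> {..<m}" "0 < taylor {..<m} c x T"
    have R: "rayleigh {..<m} (taylor {..<m} c x)" using assms(1) by (intro rayleigh_taylor) auto
    show "0 < taylor {..<m} c x S"
      by (rule rayleigh_support_downward[OF finite_lessThan R pos(2,1) ST(2,3,1)])
  qed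
qed

section \<open>Polarisation\<close>

text \<open>
  The \<open>n * d\<close> variables of the polarisation come in \<open>n\<close> blocks of length \<open>d\<close>: the variable with
  index \<open>i * d + k\<close> is the \<open>k\<close>-th copy of the original variable \<open>i\<close>.
\<close>

definition block :: "nat \<Rightarrow> nat \<Rightarrow> nat set \<Rightarrow> nat set" where
  "block d i S = {k. k < d \<and> i * d + k \<in> S}"

text \<open>
  The elementary symmetric polynomial of degree \<open>a\<close> in \<open>d\<close> variables, divided by its number of terms.
  It is the polarisation of the power \<open>y ^ a\<close>.
\<close>

definition elem_mean :: "nat \<Rightarrow> nat \<Rightarrow> (nat \<Rightarrow> 'a) \<Rightarrow> 'a::real_field" where
  "elem_mean d a z = setpoly {..<d} (\<lambda>S. if card S = a then 1 / real (d choose a) else 0) z"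

text \<open>
  The coefficients of the polarisation of the monomial with exponents \<open>e\<close>.
\<close>

definition polar_coeff :: "nat \<Rightarrow> nat \<Rightarrow> (nat \<Rightarrow> nat) \<Rightarrow> nat set \<Rightarrow> real" where
  "polar_coeff d n e S = (\<Prod>i<n. if card (block d i S) = e i then 1 / real (d choose e i) else 0)"

lemma elem_mean_const:
  assumes "a \<le> d"
  shows "elem_mean d a (\<lambda>_. y) = y ^ a"
proof -
  have "elem_mean d a (\<lambda>_. y) = (\<Sum>S\<in>Pow {..<d}. if card S = a then y ^ a / of_nat (d choose a) else 0)"
    unfolding elem_mean_def setpoly_def by (intro sum.cong refl) (auto simp: field_simps)
  also have "\<dots> = (\<Sum>S\<in>{S\<in>Pow {..<d}. card S = a}. y ^ a / of_nat (d choose a))"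
    by (rule sum.inter_filter[symmetric]) simp
  also have "\<dots> = of_nat (card {S\<in>Pow {..<d}. card S = a}) * (y ^ a / of_nat (d choose a))"
    by simp
  also have "card {S\<in>Pow {..<d}. card S = a} = d choose a"
    using n_subsets[of "{..<d}" a] by simp
  finally show ?thesis using assms by simp
qed

lemma block_index_less:
  assumes "i < n" "k < (d::nat)"
  shows "i * d + k < n * d"
proof -
  have "i * d + k < Suc i * d" using assms(2) by simp
  also have "\<dots> \<le> n * d" using assms(1) by (intro mult_right_mono) auto
  finally show ?thesis .
qed

lemma block_union_shift:
  assumes "A \<subseteq> {..<n * d}" "B \<subseteq> {..<d}"
  shows "block d n (A \<union> (+) (n * d) ` B) = B"
    and "i < n \<Longrightarrow> block d i (A \<union> (+) (n * d) ` B) = block d i A"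
proof -
  show "block d n (A \<union> (+) (n * d) ` B) = B"
    using assms by (auto simp: block_def)
  show "block d i (A \<union> (+) (n * d) ` B) = block d i A" if "i < n"
    using block_index_less[OF that, of _ d] by (fastforce simp: block_def)
qed

lemma split_last_block:
  assumes "S \<subseteq> {..<Suc n * d}"
  shows "S \<inter> {..<n * d} \<union> (+) (n * d) ` block d n S = S"
proof (intro equalityI subsetI)
  fix l assume l: "l \<in> S"
  show "l \<in> S \<inter> {..<n * d} \<union> (+) (n * d) ` block d n S"
  proof (cases "l < n * d")
    case False
    then have "l = n * d + (l - n * d)" "l - n * d \<in> block d n S"
      using l assms by (auto simp: block_def)
    then show ?thesis by blast
  qed (use l in auto)
qed (auto simp: block_def)

lemma setpoly_polar_coeff:
  "setpoly {..<n * d} (polar_coeff d n e) x = (\<Prod>i<n. elem_mean d (e i) (\<lambda>k. x (i * d + k)))"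
proof (induction n)
  case 0
  then show ?case by (simp add: polar_coeff_def)
next
  case (Suc n)
  let ?w = "\<lambda>B. if card B = e n then 1 / real (d choose e n) else 0"
  let ?y = "\<lambda>k. x (n * d + k)"
  let ?j = "\<lambda>(A, B). A \<union> (+) (n * d) ` B"
  have "setpoly {..<Suc n * d} (polar_coeff d (Suc n) e) x
      = (\<Sum>(A, B)\<in>Pow {..<n * d} \<times> Pow {..<d}.
          (of_real (polar_coeff d n e A) * (\<Prod>i\<in>A. x i)) * (of_real (?w B) * (\<Prod>k\<in>B. ?y k)))"
    unfolding setpoly_def
  proof (rule sum.reindex_bij_witness[of _ ?j "\<lambda>S. (S \<inter> {..<n * d}, block d n S)"])
    fix S assume S: "S \<in> Pow {..<Suc n * d}"
    then show "?j (S \<inter> {..<n * d}, block d n S) = S" using split_last_block[of S n d] by simp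
    show "(S \<inter> {..<n * d}, block d n S) \<in> Pow {..<n * d} \<times> Pow {..<d}"
      by (auto simp: block_def)
    let ?A = "S \<inter> {..<n * d}" and ?B = "block d n S"
    have B: "?B \<subseteq> {..<d}" by (auto simp: block_def)
    have eq: "S = ?A \<union> (+) (n * d) ` ?B" using split_last_block[of S n d] S by simp
    have "polar_coeff d (Suc n) e S = (\<Prod>i<n. if card (block d i S) = e i then 1 / real (d choose e i) else 0) * ?w ?B"
      by (simp add: polar_coeff_def)
    also have "(\<Prod>i<n. if card (block d i S) = e i then 1 / real (d choose e i) else 0)
        = polar_coeff d n e ?A"
      unfolding polar_coeff_def
    proof (rule prod.cong[OF refl])
      fix i assume "i \<in> {..<n}"
      then have "block d i S = block d i ?A"
        using block_union_shift(2)[of ?A n d ?B i] B eq by auto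
      then show "(if card (block d i S) = e i then 1 / real (d choose e i) else 0)
          = (if card (block d i ?A) = e i then 1 / real (d choose e i) else 0)" by simp
    qed
    finally have c: "polar_coeff d (Suc n) e S = polar_coeff d n e ?A * ?w ?B" .
    have "(\<Prod>i\<in>S. x i) = (\<Prod>i\<in>?A \<union> (+) (n * d) ` ?B. x i)" using eq by simp
    also have "\<dots> = (\<Prod>i\<in>?A. x i) * (\<Prod>i\<in>(+) (n * d) ` ?B. x i)"
      by (rule prod.union_disjoint) (auto simp: block_def)
    also have "(\<Prod>i\<in>(+) (n * d) ` ?B. x i) = (\<Prod>k\<in>?B. ?y k)"
      by (simp add: prod.reindex)
    finally have p: "(\<Prod>i\<in>S. x i) = (\<Prod>i\<in>?A. x i) * (\<Prod>k\<in>?B. ?y k)" .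
    show "(case (?A, ?B) of (A, B) \<Rightarrow>
        (of_real (polar_coeff d n e A) * (\<Prod>i\<in>A. x i)) * (of_real (?w B) * (\<Prod>k\<in>B. ?y k)))
        = of_real (polar_coeff d (Suc n) e S) * (\<Prod>i\<in>S. x i)"
      unfolding c p by (simp only: prod.case of_real_mult mult_ac)
  next
    fix AB assume "AB \<in> Pow {..<n * d} \<times> Pow {..<d}"
    then obtain A B where AB: "AB = (A, B)" "A \<subseteq> {..<n * d}" "B \<subseteq> {..<d}" by auto
    have "?j (A, B) \<inter> {..<n * d} = A" using AB by auto
    then show "(?j AB \<inter> {..<n * d}, block d n (?j AB)) = AB"
      using block_union_shift(1)[OF AB(2,3)] AB(1) by simp
    show "?j AB \<in> Pow {..<Suc n * d}" using AB by fastforce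
  qed
  also have "\<dots> = setpoly {..<n * d} (polar_coeff d n e) x * elem_mean d (e n) ?y"
    by (simp add: sum.cartesian_product[symmetric] sum_product setpoly_def elem_mean_def)
  finally show ?case by (simp add: Suc.IH)
qed

lemma card_eq_sum_blocks:
  assumes "S \<subseteq> {..<n * d}"
  shows "card S = (\<Sum>i<n. card (block d i S))"
  using assms
proof (induction n arbitrary: S)
  case (Suc n)
  let ?A = "S \<inter> {..<n * d}" and ?B = "block d n S"
  have B: "?B \<subseteq> {..<d}" by (auto simp: block_def)
  have eq: "S = ?A \<union> (+) (n * d) ` ?B" using split_last_block[OF Suc.prems] by simp
  have "card S = card (?A \<union> (+) (n * d) ` ?B)" using eq by simp
  also have "\<dots> = card ?A + card ((+) (n * d) ` ?B)"
    using B by (intro card_Un_disjoint) (auto simp: block_def intro: finite_subset)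
  also have "card ((+) (n * d) ` ?B) = card ?B" by (intro card_image) auto
  also have "card ?A = (\<Sum>i<n. card (block d i ?A))" by (rule Suc.IH) auto
  also have "\<dots> = (\<Sum>i<n. card (block d i S))"
  proof (rule sum.cong[OF refl])
    fix i assume "i \<in> {..<n}"
    then show "card (block d i ?A) = card (block d i S)"
      using block_union_shift(2)[of ?A n d ?B i] B eq by auto
  qed
  finally show ?case by simp
qed simp

lemma polar_coeff_nonneg: "0 \<le> polar_coeff d n e S"
  unfolding polar_coeff_def by (intro prod_nonneg) auto

lemma polar_coeff_card:
  assumes "S \<subseteq> {..<n * d}" "polar_coeff d n e S \<noteq> 0"
  shows "card S = (\<Sum>i<n. e i)"
proof -
  have "card (block d i S) = e i" if "i < n" for i
    using assms(2) that unfolding polar_coeff_def by (auto split: if_splits)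
  then show ?thesis unfolding card_eq_sum_blocks[OF assms(1)] by simp
qed

lemma polar_coeff_pos_exists:
  assumes "\<And>i. i < n \<Longrightarrow> e i \<le> d"
  shows "\<exists>S\<subseteq>{..<n * d}. 0 < polar_coeff d n e S"
proof (rule ccontr)
  assume "\<not> ?thesis"
  then have "polar_coeff d n e S = 0" if "S \<subseteq> {..<n * d}" for S
    using that polar_coeff_nonneg[of d n e S] by (auto simp: not_less)
  then have "setpoly {..<n * d} (polar_coeff d n e) (\<lambda>_. 1) = (0 :: real)"
    by (simp add: setpoly_def)
  moreover have "setpoly {..<n * d} (polar_coeff d n e) (\<lambda>_. 1) = (1 :: real)"
    using assms by (simp add: setpoly_polar_coeff elem_mean_const)
  ultimately show False by simp
qed

text \<open>
  The variables are polarised one at a time. As a function of the variable \<open>j\<close> alone, with earlier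
  variables already replaced by their blocks and all values in the upper half-plane, the polynomial
  is stable of degree at most \<open>d\<close>, so the Grace--Walsh--Szego theorem applies.
\<close>

lemma polarization_nonzero:
  fixes a :: "'k \<Rightarrow> real" and e :: "'k \<Rightarrow> nat \<Rightarrow> nat" and z :: "nat \<Rightarrow> complex"
  assumes "finite M" and deg: "\<And>k i. k \<in> M \<Longrightarrow> i < n \<Longrightarrow> e k i \<le> d"
    and stable: "\<And>x :: nat \<Rightarrow> complex. (\<And>i. i < n \<Longrightarrow> 0 < Im (x i)) \<Longrightarrow>
      (\<Sum>k\<in>M. of_real (a k) * (\<Prod>i<n. x i ^ e k i)) \<noteq> 0"
    and z: "\<And>l. l < n * d \<Longrightarrow> 0 < Im (z l)"
  shows "(\<Sum>k\<in>M. of_real (a k) * (\<Prod>i<n. elem_mean d (e k i) (\<lambda>q. z (i * d + q)))) \<noteq> 0"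
proof -
  let ?E = "\<lambda>k i. elem_mean d (e k i) (\<lambda>q. z (i * d + q))"
  have "(\<Sum>k\<in>M. of_real (a k) * ((\<Prod>i<j. ?E k i) * (\<Prod>i\<in>{j..<n}. x i ^ e k i))) \<noteq> 0"
    if "j \<le> n" "\<And>i. i < n \<Longrightarrow> 0 < Im (x i)" for j x
    using that
  proof (induction j arbitrary: x)
    case 0
    then show ?case using stable[of x] by (simp add: atLeast0LessThan)
  next
    case (Suc j)
    define w where "w = (\<lambda>k. of_real (a k) * ((\<Prod>i<j. ?E k i) * (\<Prod>i\<in>{Suc j..<n}. x i ^ e k i)))"
    define p where "p = (\<Sum>k\<in>M. monom (w k) (e k j))"
    have j: "j < n" using Suc.prems by simp
    have "poly p y \<noteq> 0" if y: "0 < Im y" for y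
    proof -
      let ?x = "x(j := y)"
      have "(\<Prod>i\<in>{j..<n}. ?x i ^ e k i) = y ^ e k j * (\<Prod>i\<in>{Suc j..<n}. x i ^ e k i)" for k
      proof -
        have "{j..<n} = insert j {Suc j..<n}" using j by auto
        then show ?thesis by simp
      qed
      then have "poly p y = (\<Sum>k\<in>M. of_real (a k) * ((\<Prod>i<j. ?E k i) * (\<Prod>i\<in>{j..<n}. ?x i ^ e k i)))"
        by (simp add: p_def w_def poly_sum poly_monom mult_ac)
      also have "\<dots> \<noteq> 0" using Suc.prems y j by (intro Suc.IH) auto
      finally show ?thesis .
    qed
    moreover have "degree p \<le> d"
      unfolding p_def using assms(1) deg j
      by (intro degree_sum_le) (auto intro: order_trans[OF degree_monom_le])
    ultimately have "(\<Sum>S\<in>Pow {..<d}. coeff p (card S) / of_nat (d choose card S)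
        * (\<Prod>q\<in>S. z (j * d + q))) \<noteq> 0"
      using z block_index_less[OF j] by (intro grace_walsh_szego) auto
    also have "(\<Sum>S\<in>Pow {..<d}. coeff p (card S) / of_nat (d choose card S) * (\<Prod>q\<in>S. z (j * d + q)))
        = (\<Sum>S\<in>Pow {..<d}. \<Sum>k\<in>M. w k * (of_real (if card S = e k j then 1 / real (d choose e k j) else 0)
            * (\<Prod>q\<in>S. z (j * d + q))))"
    proof (rule sum.cong[OF refl])
      fix S :: "nat set"
      have "coeff p (card S) = (\<Sum>k\<in>M. if card S = e k j then w k else 0)"
        by (auto simp: p_def coeff_sum intro!: sum.cong)
      then show "coeff p (card S) / of_nat (d choose card S) * (\<Prod>q\<in>S. z (j * d + q))
          = (\<Sum>k\<in>M. w k * (of_real (if card S = e k j then 1 / real (d choose e k j) else 0)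
            * (\<Prod>q\<in>S. z (j * d + q))))"
        by (auto simp: sum_distrib_right sum_divide_distrib intro!: sum.cong)
    qed
    also have "\<dots> = (\<Sum>k\<in>M. w k * ?E k j)"
      unfolding elem_mean_def setpoly_def sum_distrib_left by (rule sum.swap)
    also have "\<dots> = (\<Sum>k\<in>M. of_real (a k) * ((\<Prod>i<Suc j. ?E k i) * (\<Prod>i\<in>{Suc j..<n}. x i ^ e k i)))"
      by (simp add: w_def mult_ac)
    finally show ?case .
  qed
  from this[of n "\<lambda>_. \<i>"] show ?thesis by simp
qed

section \<open>Stable polynomials are Garding\<close>

lemma monom_degree_eq_sum:
  assumes "finite A" "Poly_Mapping.keys k \<subseteq> A"
  shows "monom_degree k = (\<Sum>i\<in>A. Poly_Mapping.lookup k i)"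
  unfolding monom_degree_def using assms by (intro sum.mono_neutral_left) (auto simp: in_keys_iff)

lemma monom_degree_le_total_degree:
  assumes "k \<in> Poly_Mapping.keys f"
  shows "monom_degree k \<le> total_degree f"
  unfolding total_degree_def using assms by (intro Max_ge) auto

lemma total_degree_attained:
  assumes "f \<noteq> 0"
  shows "\<exists>k\<in>Poly_Mapping.keys f. monom_degree k = total_degree f"
proof -
  have "Poly_Mapping.keys f \<noteq> {}" using assms by simp
  then obtain k where k: "k \<in> Poly_Mapping.keys f" by blast
  have "total_degree f \<in> insert 0 (monom_degree ` Poly_Mapping.keys f)"
    unfolding total_degree_def by (intro Max_in) auto
  then show ?thesis using monom_degree_le_total_degree[OF k] k by force
qed

lemma lookup_top_part:
  "Poly_Mapping.lookup (top_part f) k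
    = (if monom_degree k = total_degree f then Poly_Mapping.lookup f k else 0)"
proof -
  let ?T = "{k \<in> Poly_Mapping.keys f. monom_degree k = total_degree f}"
  have "Poly_Mapping.lookup (top_part f) k
      = (\<Sum>m\<in>?T. if m = k then Poly_Mapping.lookup f m else 0)"
    by (auto simp: top_part_def lookup_sum lookup_single when_def intro!: sum.cong)
  also have "\<dots> = (if k \<in> ?T then Poly_Mapping.lookup f k else 0)" by simp
  finally show ?thesis by (auto simp: in_keys_iff)
qed

lemma multi_affine_garding_imp_garding_comp:
  assumes "multi_affine_garding m g" "strictly_positive_matrix m n A" "f \<in> polys n"
    and "\<And>x. (\<And>i. n \<le> i \<Longrightarrow> x i = 0) \<Longrightarrow> eval_poly f x = eval_poly g (affine_map m n A b x)"
  shows "garding n f"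
proof -
  have "strictly_positive_affine m n (affine_map m n A b)"
    using assms(2) by (auto simp: strictly_positive_affine_def)
  moreover have "\<forall>x \<in> topspace (Euclidean_space n). eval_poly f x = eval_poly g (affine_map m n A b x)"
    using assms(4) by (simp add: topspace_Euclidean_space)
  ultimately show ?thesis unfolding garding_def using assms(1,3) by blast
qed

lemma garding_zero: "garding n 0"
proof (rule multi_affine_garding_imp_garding_comp[where m = 0 and g = 0])
  show "multi_affine_garding 0 0"
    by (simp add: multi_affine_garding_def garding_component_nonempty_iff polys_def multi_affine_def)
qed (auto simp: strictly_positive_matrix_def polys_def eval_poly_def)

text \<open>
  The polarisation is taken with blocks of length \<open>d = total_degree f\<close> in every variable, which is
  enough room for each exponent. It preserves degrees and signs of coefficients monomial by
  monomial, so its leading form inherits nonnegativity from \<open>f\<close>.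
\<close>

theorem S_n_subset_G_n: "S_n n \<subseteq> G_n n"
proof
  fix f assume "f \<in> S_n n"
  then have f: "f \<in> polys n" and st: "real_stable n f" and top: "nonneg_coeffs (top_part f)"
    by (auto simp: S_n_def)
  show "f \<in> G_n n"
  proof (cases "f = 0")
    case True
    then show ?thesis by (simp add: G_n_def garding_zero)
  next
    case False
    define d where "d = total_degree f"
    let ?M = "Poly_Mapping.keys f" and ?a = "Poly_Mapping.lookup f" and ?e = "Poly_Mapping.lookup"
    have degs: "monom_degree k = (\<Sum>i<n. ?e k i)" if "k \<in> ?M" for k
      using that f by (intro monom_degree_eq_sum) (auto simp: polys_def)
    have le_d: "?e k i \<le> d" if "k \<in> ?M" "i < n" for k i
    proof -
      have "?e k i \<le> (\<Sum>i<n. ?e k i)" using that(2) by (intro member_le_sum) auto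
      then show ?thesis using degs[OF that(1)] monom_degree_le_total_degree[OF that(1)] by (simp add: d_def)
    qed
    define c where "c = (\<lambda>S. \<Sum>k\<in>?M. ?a k * polar_coeff d n (?e k) S)"
    have evalc: "setpoly {..<n * d} c x
        = (\<Sum>k\<in>?M. of_real (?a k) * (\<Prod>i<n. elem_mean d (?e k i) (\<lambda>q. x (i * d + q))))"
      for x :: "nat \<Rightarrow> 'a::real_field"
      unfolding c_def setpoly_sum_coeffs setpoly_polar_coeff ..
    have R: "rayleigh {..<n * d} c"
    proof (rule stable_imp_rayleigh)
      fix z :: "nat \<Rightarrow> complex" assume z: "\<And>i. i \<in> {..<n * d} \<Longrightarrow> 0 < Im (z i)"
      show "setpoly {..<n * d} c z \<noteq> 0"
        unfolding evalc
      proof (rule polarization_nonzero)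
        fix x :: "nat \<Rightarrow> complex" assume "\<And>i. i < n \<Longrightarrow> 0 < Im (x i)"
        then have "eval_poly f x \<noteq> 0" using st False by (auto simp: real_stable_def)
        then show "(\<Sum>k\<in>?M. of_real (?a k) * (\<Prod>i<n. x i ^ ?e k i)) \<noteq> 0"
          by (simp add: eval_polys[OF f])
      qed (use le_d z in auto)
    qed simp
    have a_top: "0 \<le> ?a k" if "monom_degree k = d" for k
      using top[unfolded nonneg_coeffs_def, rule_format, of k] that lookup_top_part[of f k]
      by (simp add: d_def)
    have P: "positive_top {..<n * d} c"
      unfolding positive_top_def
    proof (intro exI[of _ d] conjI allI impI)
      fix S assume S: "S \<subseteq> {..<n * d}"
      have deg: "monom_degree k = card S" if "k \<in> ?M" "polar_coeff d n (?e k) S \<noteq> 0" for k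
        using polar_coeff_card[OF S that(2)] degs[OF that(1)] by simp
      show "c S = 0" if "d < card S"
      proof -
        have "polar_coeff d n (?e k) S = 0" if "k \<in> ?M" for k
          using deg[OF that] monom_degree_le_total_degree[OF that] \<open>d < card S\<close>
          by (force simp: d_def)
        then show ?thesis by (simp add: c_def)
      qed
      show "0 \<le> c S" if "card S = d"
      proof -
        have "0 \<le> ?a k * polar_coeff d n (?e k) S" if "k \<in> ?M" for k
          using deg[OF that] a_top[of k] \<open>card S = d\<close> polar_coeff_nonneg[of d n "?e k" S]
          by (cases "polar_coeff d n (?e k) S = 0") auto
        then show ?thesis unfolding c_def by (intro sum_nonneg)
      qed
    next
      obtain k where k: "k \<in> ?M" "monom_degree k = d"
        using total_degree_attained[OF False] by (auto simp: d_def)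
      then have ak: "0 < ?a k" using a_top[of k] by (simp add: in_keys_iff less_le)
      obtain S where S: "S \<subseteq> {..<n * d}" "0 < polar_coeff d n (?e k) S"
        using polar_coeff_pos_exists[of n "?e k" d] le_d[OF k(1)] by blast
      have cS: "card S = d" using polar_coeff_card[OF S(1)] S(2) degs[OF k(1)] k(2) by force
      have "0 < c S" unfolding c_def
      proof (rule sum_pos2[of _ k])
        show "0 < ?a k * polar_coeff d n (?e k) S" using ak S by simp
        fix k' assume k': "k' \<in> ?M"
        show "0 \<le> ?a k' * polar_coeff d n (?e k') S"
        proof (cases "polar_coeff d n (?e k') S = 0")
          case nz: False
          have "monom_degree k' = d" using polar_coeff_card[OF S(1) nz] degs[OF k'] cS by simp
          then show ?thesis using a_top polar_coeff_nonneg by simp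
        qed simp
      qed (use k in auto)
      then show "\<exists>S. S \<subseteq> {..<n * d} \<and> card S = d \<and> 0 < c S" using S cS by blast
    qed
    let ?g = "multi_affine_poly (n * d) c"
    let ?A = "\<lambda>l j. if j = l div d then 1 else (0::real)"
    have "garding n f"
    proof (rule multi_affine_garding_imp_garding_comp[OF rayleigh_imp_garding[OF R P] _ f, of ?A])
      have ld: "l div d < n" if "l < n * d" for l
        using that by (simp add: less_mult_imp_div_less)
      then show "strictly_positive_matrix (n * d) n ?A"
        by (simp add: strictly_positive_matrix_def)
      fix x :: "nat \<Rightarrow> real"
      have \<mu>: "affine_map (n * d) n ?A (\<lambda>_. 0) x (i * d + q) = x i" if "i < n" "q < d" for i q
      proof -
        have "(i * d + q) div d = i" using that by simp
        then show ?thesis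
          using block_index_less[OF that] that by (simp add: affine_map_def mult_delta_left)
      qed
      have "eval_poly ?g (affine_map (n * d) n ?A (\<lambda>_. 0) x)
          = (\<Sum>k\<in>?M. ?a k * (\<Prod>i<n. elem_mean d (?e k i) (\<lambda>q. affine_map (n * d) n ?A (\<lambda>_. 0) x (i * d + q))))"
        unfolding eval_multi_affine_poly evalc by simp
      also have "\<dots> = (\<Sum>k\<in>?M. ?a k * (\<Prod>i<n. x i ^ ?e k i))"
      proof (intro sum.cong prod.cong refl arg_cong2[of _ _ _ _ "(*)"])
        fix k i assume k: "k \<in> ?M" and i: "i \<in> {..<n}"
        have "elem_mean d (?e k i) (\<lambda>q. affine_map (n * d) n ?A (\<lambda>_. 0) x (i * d + q))
            = elem_mean d (?e k i) (\<lambda>_. x i)"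
          unfolding elem_mean_def using i by (intro setpoly_cong \<mu>) auto
        then show "elem_mean d (?e k i) (\<lambda>q. affine_map (n * d) n ?A (\<lambda>_. 0) x (i * d + q)) = x i ^ ?e k i"
          using le_d[OF k] i by (simp add: elem_mean_const)
      qed
      also have "\<dots> = eval_poly f x" by (simp add: eval_polys[OF f])
      finally show "eval_poly f x = eval_poly ?g (affine_map (n * d) n ?A (\<lambda>_. 0) x)" by simp
    qed
    then show ?thesis by (simp add: G_n_def)
  qed
qed

section \<open>A Garding polynomial that is not stable\<close>

lemma multi_affine_garding_imp_garding:
  assumes "multi_affine_garding m g"
  shows "garding m g"
proof (rule multi_affine_garding_imp_garding_comp[OF assms,
    of m "\<lambda>i j. if j = i then 1 else 0" g "\<lambda>_. 0"])
  show "strictly_positive_matrix m m (\<lambda>i j. if j = i then 1 else 0)"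
    by (simp add: strictly_positive_matrix_def)
  show "g \<in> polys m" using assms by (simp add: multi_affine_garding_def)
  fix x :: "nat \<Rightarrow> real" assume x: "\<And>i. m \<le> i \<Longrightarrow> x i = 0"
  have "affine_map m m (\<lambda>i j. if j = i then 1 else 0) (\<lambda>_. 0) x = x"
    using x by (auto simp: affine_map_def fun_eq_iff mult_delta_left)
  then show "eval_poly g x = eval_poly g (affine_map m m (\<lambda>i j. if j = i then 1 else 0) (\<lambda>_. 0) x)"
    by simp
qed

definition prod_minus_one :: "nat \<Rightarrow> nat set \<Rightarrow> real" where
  "prod_minus_one m S = (if S = {..<m} then 1 else if S = {} then - 1 else 0)"

lemma setpoly_prod_minus_one:
  assumes "0 < m"
  shows "setpoly {..<m} (prod_minus_one m) x = (\<Prod>i<m. x i) - 1"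
proof -
  have ne: "{..<m} \<noteq> {}" using assms by auto
  have "setpoly {..<m} (prod_minus_one m) x
      = (\<Sum>S\<in>{{..<m}, {}}. of_real (prod_minus_one m S) * (\<Prod>i\<in>S. x i))"
    unfolding setpoly_def by (intro sum.mono_neutral_right) (auto simp: prod_minus_one_def)
  then show ?thesis using ne by (simp add: prod_minus_one_def)
qed

lemma taylor_prod_minus_one:
  assumes "S \<subseteq> {..<m}" "S \<noteq> {}"
  shows "taylor {..<m} (prod_minus_one m) x S = (\<Prod>i\<in>{..<m} - S. x i)"
proof -
  have "taylor {..<m} (prod_minus_one m) x S
      = (\<Sum>T\<in>{{..<m} - S}. prod_minus_one m (T \<union> S) * (\<Prod>i\<in>T. x i))"
    unfolding taylor_def setpoly_def of_real_eq_id id_apply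
  proof (rule sum.mono_neutral_right)
    show "\<forall>T\<in>Pow ({..<m} - S) - {{..<m} - S}. prod_minus_one m (T \<union> S) * (\<Prod>i\<in>T. x i) = 0"
      using assms by (auto simp: prod_minus_one_def)
  qed auto
  moreover have "{..<m} - S \<union> S = {..<m}" using assms by auto
  ultimately show ?thesis by (simp add: prod_minus_one_def)
qed

text \<open>
  All proper derivatives of \<open>\<Prod>x\<^sub>i - 1\<close> are subproducts, and none can vanish where the full
  product exceeds 1.
\<close>

lemma prod_minus_one_garding:
  assumes "0 < m"
  shows "multi_affine_garding m (multi_affine_poly m (prod_minus_one m))"
proof (rule multi_affine_garding_criterion)
  let ?t = "taylor {..<m} (prod_minus_one m)"
  have t0: "?t x {} = (\<Prod>i<m. x i) - 1" for x
    unfolding taylor_empty using assms by (rule setpoly_prod_minus_one)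
  have "1 < (2::real) ^ m" using assms by simp
  then show base: "0 < ?t (\<lambda>_. 2) {}" unfolding t0 by simp
  show "0 \<le> ?t (\<lambda>_. 2) S" if "S \<subseteq> {..<m}" for S
    using base that by (cases "S = {}") (auto simp: taylor_prod_minus_one prod_nonneg)
  fix x S T
  assume pos: "0 < ?t x {}" "\<And>S. S \<subseteq> {..<m} \<Longrightarrow> 0 \<le> ?t x S" and ST: "S \<subseteq> T" "T \<subseteq> {..<m}"
  show "0 < ?t x S"
  proof (cases "S = {}")
    case False
    have S: "S \<subseteq> {..<m}" using ST by auto
    have "(\<Prod>i<m. x i) = (\<Prod>i\<in>{..<m} - S. x i) * (\<Prod>i\<in>S. x i)"
      using S by (intro prod.subset_diff) auto
    moreover have "1 < (\<Prod>i<m. x i)" using pos(1) unfolding t0 by linarith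
    ultimately have "(\<Prod>i\<in>{..<m} - S. x i) \<noteq> 0" by (metis mult_zero_left not_one_less_zero)
    then show ?thesis using pos(2)[OF S] taylor_prod_minus_one[OF S False] by (simp add: less_le)
  qed (use pos in simp)
qed

lemma S_all_neq_G_all: "S_all \<noteq> G_all"
proof -
  let ?f = "multi_affine_poly 3 (prod_minus_one 3)"
  have "?f \<in> G_all"
    using multi_affine_garding_imp_garding[OF prod_minus_one_garding[of 3]]
    by (auto simp: G_all_def G_n_def)
  moreover have "?f \<notin> S_all"
  proof
    assume "?f \<in> S_all"
    then obtain n where st: "real_stable n ?f" by (auto simp: S_all_def S_n_def)
    have "Poly_Mapping.lookup ?f (squarefree_monom {}) = - 1"
      by (subst lookup_multi_affine_poly) (auto simp: prod_minus_one_def lessThan_empty_iff dest: sym)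
    then have "?f \<noteq> 0" by auto
    let ?\<omega> = "cis (2 * pi / 3)"
    have "0 < Im ?\<omega>" by (simp add: sin_gt_zero)
    moreover have "\<forall>x :: nat \<Rightarrow> complex. (\<forall>i<n. 0 < Im (x i)) \<longrightarrow> eval_poly ?f x \<noteq> 0"
      using st \<open>?f \<noteq> 0\<close> unfolding real_stable_def by blast
    ultimately have "eval_poly ?f (\<lambda>_. ?\<omega>) \<noteq> 0" by simp
    moreover have "eval_poly ?f (\<lambda>_. ?\<omega>) = ?\<omega> ^ 3 - 1"
      by (simp add: eval_multi_affine_poly setpoly_prod_minus_one)
    moreover have "?\<omega> ^ 3 = 1" by (simp add: Complex.DeMoivre)
    ultimately show False by simp
  qed
  ultimately show ?thesis by blast
qed

section \<open>Polynomials of degree at most two\<close>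

definition monom_eval :: "monom \<Rightarrow> (nat \<Rightarrow> 'a) \<Rightarrow> 'a::real_field" where
  "monom_eval k x = (\<Prod>i\<in>Poly_Mapping.keys k. x i ^ Poly_Mapping.lookup k i)"

lemma eval_poly_monom_eval:
  "eval_poly f x = (\<Sum>k\<in>Poly_Mapping.keys f. of_real (Poly_Mapping.lookup f k) * monom_eval k x)"
  by (simp add: eval_poly_def monom_eval_def)

lemma monom_eval_superset:
  assumes "finite A" "Poly_Mapping.keys k \<subseteq> A"
  shows "monom_eval k x = (\<Prod>i\<in>A. x i ^ Poly_Mapping.lookup k i)"
  unfolding monom_eval_def using assms by (intro prod.mono_neutral_left) (auto simp: in_keys_iff)

lemma monom_eval_add: "monom_eval (k + l) x = monom_eval k x * monom_eval l x"
proof -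
  let ?A = "Poly_Mapping.keys k \<union> Poly_Mapping.keys l"
  have "monom_eval (k + l) x = (\<Prod>i\<in>?A. x i ^ Poly_Mapping.lookup (k + l) i)"
    using Poly_Mapping.keys_add[of k l] by (intro monom_eval_superset) auto
  also have "\<dots> = (\<Prod>i\<in>?A. x i ^ Poly_Mapping.lookup k i) * (\<Prod>i\<in>?A. x i ^ Poly_Mapping.lookup l i)"
    by (simp add: lookup_add power_add prod.distrib)
  also have "\<dots> = monom_eval k x * monom_eval l x"
    by (simp add: monom_eval_superset[of ?A])
  finally show ?thesis .
qed

lemma monom_eval_zero [simp]: "monom_eval 0 x = 1"
  by (simp add: monom_eval_def)

lemma monom_eval_single [simp]: "monom_eval (Poly_Mapping.single i 1) x = x i"
  by (simp add: monom_eval_def)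

lemma monom_degree_add: "monom_degree (k + l) = monom_degree k + monom_degree l"
proof -
  let ?A = "Poly_Mapping.keys k \<union> Poly_Mapping.keys l"
  have "monom_degree (k + l) = (\<Sum>i\<in>?A. Poly_Mapping.lookup (k + l) i)"
    using Poly_Mapping.keys_add[of k l] by (intro monom_degree_eq_sum) auto
  also have "\<dots> = (\<Sum>i\<in>?A. Poly_Mapping.lookup k i) + (\<Sum>i\<in>?A. Poly_Mapping.lookup l i)"
    by (simp add: lookup_add sum.distrib)
  also have "\<dots> = monom_degree k + monom_degree l"
    by (simp add: monom_degree_eq_sum[of ?A])
  finally show ?thesis .
qed

lemma monom_degree_single [simp]: "monom_degree (Poly_Mapping.single i 1) = 1"
  by (simp add: monom_degree_def)

lemma monom_degree_zero [simp]: "monom_degree 0 = 0"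
  by (simp add: monom_degree_def)

lemma monom_split_variable:
  assumes "k \<noteq> (0 :: monom)"
  obtains i l where "k = l + Poly_Mapping.single i 1"
proof -
  obtain i where i: "Poly_Mapping.lookup k i \<noteq> 0"
    using assms by (metis poly_mapping_eqI lookup_zero)
  have "k = (k - Poly_Mapping.single i 1) + Poly_Mapping.single i 1"
    using i by (intro poly_mapping_eqI) (auto simp: lookup_add lookup_minus lookup_single when_def)
  then show ?thesis using that by blast
qed

lemma monom_degree_le_2_cases:
  assumes "monom_degree k \<le> 2"
  obtains "k = 0" | i where "k = Poly_Mapping.single i 1"
    | i j where "k = Poly_Mapping.single i 1 + Poly_Mapping.single j 1"
proof (cases "k = 0")
  case False
  then obtain i l where l: "k = l + Poly_Mapping.single i 1" by (rule monom_split_variable)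
  show ?thesis
  proof (cases "l = 0")
    case False
    then obtain j l' where l': "l = l' + Poly_Mapping.single j 1" by (rule monom_split_variable)
    have "l' = 0"
    proof (rule ccontr)
      assume "l' \<noteq> 0"
      then obtain p l'' where l'': "l' = l'' + Poly_Mapping.single p 1" by (rule monom_split_variable)
      have "monom_degree k = monom_degree l'' + 1 + 1 + 1"
        by (simp only: l l' l'' monom_degree_add monom_degree_single)
      then show False using assms by simp
    qed
    then show ?thesis using that(3)[of j i] l l' by simp
  qed (use l that(2)[of i] in simp)
qed (use that in blast)

lemma quadratic_along_line:
  assumes "total_degree f \<le> 2"
  obtains \<alpha> \<beta> \<gamma> :: real where
    "\<And>z :: complex. eval_poly f (\<lambda>i. of_real (u i) + z * of_real (v i))
      = of_real \<alpha> + of_real \<beta> * z + of_real \<gamma> * z\<^sup>2"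
proof -
  let ?x = "\<lambda>z :: complex. \<lambda>i. of_real (u i) + z * of_real (v i)"
  have "\<exists>p :: real \<times> real \<times> real. \<forall>z. monom_eval k (?x z)
      = of_real (fst p) + of_real (fst (snd p)) * z + of_real (snd (snd p)) * z\<^sup>2"
    if "k \<in> Poly_Mapping.keys f" for k
  proof -
    have "monom_degree k \<le> 2" using monom_degree_le_total_degree[OF that] assms by simp
    then show ?thesis
    proof (cases rule: monom_degree_le_2_cases)
      case 1
      then show ?thesis by (intro exI[of _ "(1, 0, 0)"]) simp
    next
      case (2 i)
      have "monom_eval k (?x z) = ?x z i" for z unfolding 2 by (rule monom_eval_single)
      then show ?thesis by (intro exI[of _ "(u i, v i, 0)"]) (simp add: mult.commute)
    next
      case (3 i j)
      have "monom_eval k (?x z) = ?x z i * ?x z j" for z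
        unfolding 3 monom_eval_add by (simp only: monom_eval_single)
      then show ?thesis
        by (intro exI[of _ "(u i * u j, u i * v j + v i * u j, v i * v j)"])
          (simp add: algebra_simps power2_eq_square)
    qed
  qed
  then have "\<exists>p :: monom \<Rightarrow> real \<times> real \<times> real. \<forall>k\<in>Poly_Mapping.keys f. \<forall>z. monom_eval k (?x z)
      = of_real (fst (p k)) + of_real (fst (snd (p k))) * z + of_real (snd (snd (p k))) * z\<^sup>2"
    by (intro bchoice) blast
  then obtain p :: "monom \<Rightarrow> real \<times> real \<times> real" where
    p: "\<forall>k\<in>Poly_Mapping.keys f. \<forall>z. monom_eval k (?x z)
      = of_real (fst (p k)) + of_real (fst (snd (p k))) * z + of_real (snd (snd (p k))) * z\<^sup>2"
    by blast
  let ?s = "\<lambda>c. \<Sum>k\<in>Poly_Mapping.keys f. Poly_Mapping.lookup f k * c (p k)"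
  have "eval_poly f (?x z) = of_real (?s fst) + of_real (?s (\<lambda>q. fst (snd q))) * z
      + of_real (?s (\<lambda>q. snd (snd q))) * z\<^sup>2" for z
  proof -
    have "eval_poly f (?x z) = (\<Sum>k\<in>Poly_Mapping.keys f. of_real (Poly_Mapping.lookup f k)
        * (of_real (fst (p k)) + of_real (fst (snd (p k))) * z + of_real (snd (snd (p k))) * z\<^sup>2))"
      unfolding eval_poly_monom_eval using p by (intro sum.cong refl) (simp only:)
    then show ?thesis by (simp add: sum.distrib sum_distrib_right distrib_left mult.assoc)
  qed
  then show ?thesis by (rule that)
qed

lemma eval_poly_of_real: "eval_poly f (\<lambda>i. of_real (x i)) = of_real (eval_poly f x)"
  by (simp add: eval_poly_def)

definition unit_vec :: "nat \<Rightarrow> nat \<Rightarrow> real" where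
  "unit_vec i = (\<lambda>l. if l = i then 1 else 0)"

lemma eval_degree_0:
  fixes x :: "nat \<Rightarrow> real"
  assumes "total_degree f = 0"
  shows "eval_poly f x = Poly_Mapping.lookup f 0"
proof -
  have "Poly_Mapping.keys f \<subseteq> {0}"
  proof
    fix k assume "k \<in> Poly_Mapping.keys f"
    then have d: "monom_degree k = 0" using monom_degree_le_total_degree[of k f] assms by simp
    have "k = 0"
    proof (rule ccontr)
      assume "k \<noteq> 0"
      then obtain i l where "k = l + Poly_Mapping.single i 1" by (rule monom_split_variable)
      then show False using d by (simp only: monom_degree_add monom_degree_single)
    qed
    then show "k \<in> {0}" by simp
  qed
  then have "eval_poly f x = (\<Sum>k\<in>{0}. Poly_Mapping.lookup f k * monom_eval k x)"
    unfolding eval_poly_monom_eval of_real_eq_id id_apply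
    by (intro sum.mono_neutral_left) (auto simp: in_keys_iff)
  then show ?thesis by simp
qed

lemma single_one_eq_iff:
  "Poly_Mapping.single i (1::nat) = Poly_Mapping.single j 1 \<longleftrightarrow> i = j"
  by (metis keys_single singleton_inject zero_neq_one)

lemma first_difference_degree_1:
  fixes x :: "nat \<Rightarrow> real"
  assumes "total_degree f \<le> 1"
  shows "eval_poly f (\<lambda>l. x l + unit_vec i l) - eval_poly f x
    = Poly_Mapping.lookup f (Poly_Mapping.single i 1)"
proof -
  let ?m = "Poly_Mapping.single i (1::nat)"
  have mono: "monom_eval k (\<lambda>l. x l + unit_vec i l) - monom_eval k x = (if k = ?m then 1 else 0)"
    if "k \<in> Poly_Mapping.keys f" for k
  proof -
    have d: "monom_degree k \<le> 1" using monom_degree_le_total_degree[OF that] assms by simp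
    then have "monom_degree k \<le> 2" by simp
    then show ?thesis
    proof (cases rule: monom_degree_le_2_cases)
      case 1
      have "?m \<noteq> 0" by (metis monom_degree_single monom_degree_zero zero_neq_one)
      then show ?thesis using 1 by simp
    next
      case (2 j)
      then show ?thesis using single_one_eq_iff[of j i]
        by (simp only: monom_eval_single) (simp add: unit_vec_def)
    next
      case (3 j l)
      then show ?thesis using d by (simp only: monom_degree_add monom_degree_single)
    qed
  qed
  have "eval_poly f (\<lambda>l. x l + unit_vec i l) - eval_poly f x
      = (\<Sum>k\<in>Poly_Mapping.keys f. Poly_Mapping.lookup f k
          * (monom_eval k (\<lambda>l. x l + unit_vec i l) - monom_eval k x))"
    by (simp add: eval_poly_monom_eval sum_subtractf right_diff_distrib)
  also have "\<dots> = (\<Sum>k\<in>Poly_Mapping.keys f. if k = ?m then Poly_Mapping.lookup f k else 0)"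
    by (intro sum.cong refl) (simp add: mono)
  also have "\<dots> = Poly_Mapping.lookup f ?m" by (simp add: in_keys_iff)
  finally show ?thesis .
qed

lemma second_difference_degree_2:
  fixes x :: "nat \<Rightarrow> real"
  assumes "total_degree f \<le> 2"
  shows "eval_poly f (\<lambda>l. x l + (unit_vec i l + unit_vec j l)) - eval_poly f (\<lambda>l. x l + unit_vec i l)
      - eval_poly f (\<lambda>l. x l + unit_vec j l) + eval_poly f x
    = Poly_Mapping.lookup f (Poly_Mapping.single i 1 + Poly_Mapping.single j 1)
      * (if i = j then 2 else 1)"
proof -
  let ?m = "Poly_Mapping.single i (1::nat) + Poly_Mapping.single j 1"
  let ?\<Delta> = "\<lambda>k. monom_eval k (\<lambda>l. x l + (unit_vec i l + unit_vec j l))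
      - monom_eval k (\<lambda>l. x l + unit_vec i l) - monom_eval k (\<lambda>l. x l + unit_vec j l) + monom_eval k x"
  have dm: "monom_degree ?m = 2" by (simp only: monom_degree_add monom_degree_single)
  have mono: "?\<Delta> k = (if k = ?m then (if i = j then 2 else 1) else 0)"
    if "k \<in> Poly_Mapping.keys f" for k
  proof -
    have "monom_degree k \<le> 2" using monom_degree_le_total_degree[OF that] assms by simp
    then show ?thesis
    proof (cases rule: monom_degree_le_2_cases)
      case 1
      then have "k \<noteq> ?m" using dm by auto
      then show ?thesis using 1 by simp
    next
      case (2 a)
      then have "k \<noteq> ?m" using dm by (metis monom_degree_single numeral_One numeral_eq_iff semiring_norm(85))
      then show ?thesis unfolding 2 by (simp only: monom_eval_single if_False)
    next
      case (3 a b)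
      have km: "k = ?m \<longleftrightarrow> (a = i \<and> b = j) \<or> (a = j \<and> b = i)"
      proof
        assume eq: "k = ?m"
        then have "Poly_Mapping.lookup k a = Poly_Mapping.lookup ?m a" by simp
        then have "a = i \<or> a = j" unfolding 3 by (auto simp: lookup_add lookup_single when_def split: if_splits)
        then show "(a = i \<and> b = j) \<or> (a = j \<and> b = i)"
        proof
          assume "a = i"
          then show ?thesis using eq unfolding 3 by (simp only: add_left_cancel single_one_eq_iff) simp
        next
          assume "a = j"
          then show ?thesis using eq unfolding 3
            by (simp only: add.commute[of "Poly_Mapping.single i 1"] add_left_cancel single_one_eq_iff) simp
        qed
      qed (auto simp: 3 add.commute)
      have "?\<Delta> k = unit_vec i a * unit_vec j b + unit_vec i b * unit_vec j a"
        unfolding 3 monom_eval_add by (simp only: monom_eval_single) (simp add: algebra_simps)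
      also have "\<dots> = (if k = ?m then (if i = j then 2 else 1) else 0)"
        unfolding km by (auto simp: unit_vec_def)
      finally show ?thesis .
    qed
  qed
  have "eval_poly f (\<lambda>l. x l + (unit_vec i l + unit_vec j l)) - eval_poly f (\<lambda>l. x l + unit_vec i l)
      - eval_poly f (\<lambda>l. x l + unit_vec j l) + eval_poly f x
      = (\<Sum>k\<in>Poly_Mapping.keys f. Poly_Mapping.lookup f k * ?\<Delta> k)"
    by (simp add: eval_poly_monom_eval sum_subtractf sum.distrib right_diff_distrib distrib_left)
  also have "\<dots> = (\<Sum>k\<in>Poly_Mapping.keys f. if k = ?m
      then Poly_Mapping.lookup f k * (if i = j then 2 else 1) else 0)"
    by (intro sum.cong refl) (simp add: mono)
  also have "\<dots> = Poly_Mapping.lookup f ?m * (if i = j then 2 else 1)" by (simp add: in_keys_iff)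
  finally show ?thesis .
qed

text \<open>
  A multiple of each leading coefficient is a value, a first difference or a second difference of
  the polynomial function, according to the degree. The factor \<open>r\<close> is 2 for the square of a
  variable and 1 otherwise.
\<close>

lemma top_coeff_difference:
  fixes x :: "nat \<Rightarrow> real"
  assumes "f \<in> polys n" "total_degree f \<le> 2"
    and k: "k \<in> Poly_Mapping.keys f" "monom_degree k = total_degree f"
  obtains r p q where "0 < r" "\<forall>l. 0 \<le> p l" "\<forall>l. 0 \<le> q l" "\<forall>l\<ge>n. p l = 0 \<and> q l = 0"
    "Poly_Mapping.lookup f k * r \<in> {eval_poly f x,
      eval_poly f (\<lambda>l. x l + p l) - eval_poly f x,
      eval_poly f (\<lambda>l. x l + (p l + q l)) - eval_poly f (\<lambda>l. x l + p l)
        - eval_poly f (\<lambda>l. x l + q l) + eval_poly f x}"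
proof -
  have keys: "Poly_Mapping.keys k \<subseteq> {..<n}" using assms(1) k(1) by (auto simp: polys_def)
  have u: "0 \<le> unit_vec i l" for i l by (simp add: unit_vec_def)
  have un: "unit_vec i l = 0" if "i < n" "n \<le> l" for i l using that by (simp add: unit_vec_def)
  have "monom_degree k \<le> 2" using k(2) assms(2) by simp
  then show ?thesis
  proof (cases rule: monom_degree_le_2_cases)
    case 1
    then have "total_degree f = 0" using k(2) by simp
    then show ?thesis using eval_degree_0[of f x] 1 by (intro that[of 1 "\<lambda>_. 0" "\<lambda>_. 0"]) auto
  next
    case (2 i)
    have i: "i < n" using keys unfolding 2 by simp
    have "total_degree f \<le> 1" using k(2) unfolding 2 by (simp only: monom_degree_single)
    from first_difference_degree_1[OF this, of x i]
    have eq: "Poly_Mapping.lookup f k * 1 = eval_poly f (\<lambda>l. x l + unit_vec i l) - eval_poly f x"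
      unfolding 2 by simp
    show ?thesis
    proof (rule that[of 1 "unit_vec i" "\<lambda>_. 0"])
      show "Poly_Mapping.lookup f k * 1 \<in> {eval_poly f x,
          eval_poly f (\<lambda>l. x l + unit_vec i l) - eval_poly f x,
          eval_poly f (\<lambda>l. x l + (unit_vec i l + 0)) - eval_poly f (\<lambda>l. x l + unit_vec i l)
          - eval_poly f (\<lambda>l. x l + 0) + eval_poly f x}"
        unfolding eq by blast
    qed (auto simp: u un i)
  next
    case (3 i j)
    have "i \<in> Poly_Mapping.keys k" "j \<in> Poly_Mapping.keys k"
      unfolding 3 in_keys_iff by (auto simp: lookup_add lookup_single when_def)
    then have ij: "i < n" "j < n" using keys by blast+
    show ?thesis
    proof (rule that[of "if i = j then 2 else 1" "unit_vec i" "unit_vec j"])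
      show "Poly_Mapping.lookup f k * (if i = j then 2 else 1) \<in> {eval_poly f x,
          eval_poly f (\<lambda>l. x l + unit_vec i l) - eval_poly f x,
          eval_poly f (\<lambda>l. x l + (unit_vec i l + unit_vec j l)) - eval_poly f (\<lambda>l. x l + unit_vec i l)
          - eval_poly f (\<lambda>l. x l + unit_vec j l) + eval_poly f x}"
        unfolding 3 second_difference_degree_2[OF assms(2), of x i j] by blast
    qed (auto simp: u un ij)
  qed
qed

lemma prod_add_superadditive:
  fixes p q :: "'b \<Rightarrow> real"
  assumes "finite S" "S \<noteq> {}" "\<And>i. i \<in> S \<Longrightarrow> 0 \<le> p i" "\<And>i. i \<in> S \<Longrightarrow> 0 \<le> q i"
  shows "(\<Prod>i\<in>S. p i) + (\<Prod>i\<in>S. q i) \<le> (\<Prod>i\<in>S. p i + q i)"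
  using assms
proof (induction S rule: finite_ne_induct)
  case (insert i S)
  let ?P = "\<Prod>i\<in>S. p i" and ?Q = "\<Prod>i\<in>S. q i"
  have nn: "0 \<le> ?P" "0 \<le> ?Q" "0 \<le> p i" "0 \<le> q i" using insert by (auto intro!: prod_nonneg)
  have "p i * ?P + q i * ?Q \<le> (p i + q i) * (?P + ?Q)"
    using mult_nonneg_nonneg[OF nn(3,2)] mult_nonneg_nonneg[OF nn(4,1)] by (simp add: algebra_simps)
  also have "\<dots> \<le> (p i + q i) * (\<Prod>i\<in>S. p i + q i)"
    using insert nn by (intro mult_left_mono) auto
  finally show ?case using insert.hyps by simp
qed simp

text \<open>
  Products of at least one factor are superadditive on nonnegative arguments, and the constant
  term cancels.
\<close>

lemma setpoly_second_difference_nonneg: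
  fixes p q :: "nat \<Rightarrow> real"
  assumes "finite V" "\<And>S. S \<subseteq> V \<Longrightarrow> 0 \<le> c S" "\<And>i. i \<in> V \<Longrightarrow> 0 \<le> p i" "\<And>i. i \<in> V \<Longrightarrow> 0 \<le> q i"
  shows "0 \<le> setpoly V c (\<lambda>i. p i + q i) - setpoly V c p - setpoly V c q + setpoly V c (\<lambda>_. 0)"
proof -
  have "setpoly V c (\<lambda>i. p i + q i) - setpoly V c p - setpoly V c q + setpoly V c (\<lambda>_. 0)
      = (\<Sum>S\<in>Pow V. c S * ((\<Prod>i\<in>S. p i + q i) - (\<Prod>i\<in>S. p i) - (\<Prod>i\<in>S. q i) + (\<Prod>i\<in>S. 0)))"
    by (simp add: setpoly_def sum_subtractf sum.distrib right_diff_distrib distrib_left)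
  also have "\<dots> \<ge> 0"
  proof (intro sum_nonneg mult_nonneg_nonneg)
    fix S assume S: "S \<in> Pow V"
    then show "0 \<le> c S" using assms by auto
    have "finite S" using S assms(1) by (auto intro: finite_subset)
    then show "0 \<le> (\<Prod>i\<in>S. p i + q i) - (\<Prod>i\<in>S. p i) - (\<Prod>i\<in>S. q i) + (\<Prod>i\<in>S. 0)"
    proof (cases "S = {}")
      case False
      then have "(\<Prod>i\<in>S. 0) = (0::real)" using \<open>finite S\<close> by auto
      moreover have "(\<Prod>i\<in>S. p i) + (\<Prod>i\<in>S. q i) \<le> (\<Prod>i\<in>S. p i + q i)"
        using False \<open>finite S\<close> S assms by (intro prod_add_superadditive) auto
      ultimately show ?thesis by linarith
    qed simp
  qed
  finally show ?thesis .
qed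

text \<open>
  On the translate of the orthant by a point of the component, the polynomial is positive.
\<close>

lemma PRT_component_taylor_nonneg:
  assumes g: "g \<in> polys m" "multi_affine g" and C: "PRT_component m g C" and z: "z \<in> C"
    and S: "S \<subseteq> {..<m}"
  shows "0 \<le> taylor {..<m} (\<lambda>S. Poly_Mapping.lookup g (squarefree_monom S)) z S"
proof (rule setpoly_coeff_nonneg[OF finite_lessThan _ S])
  let ?c = "\<lambda>S. Poly_Mapping.lookup g (squarefree_monom S)"
  fix y :: "nat \<Rightarrow> real" assume y: "\<And>i. i \<in> {..<m} \<Longrightarrow> 0 \<le> y i"
  define y' where "y' = (\<lambda>i. if i < m then y i else 0)"
  have "PRT m C" using C by (simp add: PRT_component_def)
  then have "(\<lambda>i. z i + y' i) \<in> C" using z y unfolding PRT_iff by (simp add: y'_def)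
  then have "0 < eval_poly g (\<lambda>i. z i + y' i)"
    using PRT_component_subset[OF C] by (auto simp: pos_set_def)
  also have "eval_poly g (\<lambda>i. z i + y' i) = setpoly {..<m} (taylor {..<m} ?c z) y'"
    by (simp add: eval_multi_affine[OF g] setpoly_add)
  also have "\<dots> = setpoly {..<m} (taylor {..<m} ?c z) y"
    by (intro setpoly_cong) (auto simp: y'_def)
  finally show "0 \<le> setpoly {..<m} (taylor {..<m} ?c z) y" by simp
qed

definition linear_part :: "nat \<Rightarrow> nat \<Rightarrow> (nat \<Rightarrow> nat \<Rightarrow> real) \<Rightarrow> (nat \<Rightarrow> real) \<Rightarrow> nat \<Rightarrow> real" where
  "linear_part m n A w = (\<lambda>i. if i < m then \<Sum>j<n. A i j * w j else 0)"

lemma affine_map_add: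
  "affine_map m n A b (\<lambda>j. x j + t * w j) = (\<lambda>i. affine_map m n A b x i + t * linear_part m n A w i)"
  by (auto simp: affine_map_def linear_part_def fun_eq_iff sum.distrib sum_distrib_left algebra_simps)

lemma linear_part_add:
  "linear_part m n A (\<lambda>j. p j + q j) = (\<lambda>i. linear_part m n A p i + linear_part m n A q i)"
  by (auto simp: linear_part_def fun_eq_iff sum.distrib algebra_simps)

lemma linear_part_nonneg:
  assumes "strictly_positive_matrix m n A" "\<And>j. j < n \<Longrightarrow> 0 \<le> w j"
  shows "0 \<le> linear_part m n A w i"
  using assms by (auto simp: linear_part_def strictly_positive_matrix_def intro!: sum_nonneg)

lemma linear_part_pos:
  assumes A: "strictly_positive_matrix m n A" and w: "\<And>j. j < n \<Longrightarrow> 0 < w j" and "i < m"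
  shows "0 < linear_part m n A w i"
proof -
  have nn: "0 \<le> A i j" if "j < n" for j using A that \<open>i < m\<close> by (auto simp: strictly_positive_matrix_def)
  have "\<exists>j<n. A i j \<noteq> 0"
  proof (rule ccontr)
    assume "\<not> ?thesis"
    then have "(\<Sum>j<n. A i j) = 0" by (intro sum.neutral) auto
    then show False using A \<open>i < m\<close> by (auto simp: strictly_positive_matrix_def)
  qed
  then obtain j where j: "j < n" "A i j \<noteq> 0" by blast
  have "0 < (\<Sum>j<n. A i j * w j)"
  proof (rule sum_pos2[of _ j])
    show "0 < A i j * w j" using nn[OF j(1)] j w[OF j(1)] by simp
    show "0 \<le> A i k * w k" if "k \<in> {..<n}" for k
      using nn[of k] w[of k] that by simp
  qed (use j in auto)
  then show ?thesis using \<open>i < m\<close> by (simp add: linear_part_def)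
qed

text \<open>
  Strict positivity of the matrix makes every coordinate of \<open>\<mu> (u + t v)\<close> grow without bound, so it
  finally dominates a given point of \<open>C\<close>.
\<close>

lemma positive_ray_enters:
  assumes A: "strictly_positive_matrix m n A" and C: "PRT m C" "C \<noteq> {}" "C \<subseteq> topspace (Euclidean_space m)"
    and v: "\<And>j. j < n \<Longrightarrow> 0 < v j"
  shows "\<exists>t\<ge>0. affine_map m n A b (\<lambda>j. u j + t * v j) \<in> C"
proof -
  obtain z where z: "z \<in> C" using C by auto
  let ?L = "linear_part m n A v" and ?\<mu> = "affine_map m n A b"
  have "eventually (\<lambda>t. z i \<le> ?\<mu> u i + t * ?L i) at_top" if i: "i < m" for i
    using eventually_ge_at_top[of "(z i - ?\<mu> u i) / ?L i"]
  proof eventually_elim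
    case (elim t)
    then show ?case using linear_part_pos[OF A v i] by (simp add: field_simps)
  qed
  then have "eventually (\<lambda>t. \<forall>i\<in>{..<m}. z i \<le> ?\<mu> u i + t * ?L i) at_top"
    by (intro eventually_ball_finite) auto
  moreover have "eventually (\<lambda>t::real. 0 \<le> t) at_top" by (rule eventually_ge_at_top)
  ultimately have "eventually (\<lambda>t. (\<forall>i\<in>{..<m}. z i \<le> ?\<mu> u i + t * ?L i) \<and> 0 \<le> t) at_top"
    by eventually_elim auto
  from eventually_happens'[OF trivial_limit_at_top_linorder this]
  obtain t where t: "\<And>i. i < m \<Longrightarrow> z i \<le> ?\<mu> u i + t * ?L i" "0 \<le> t" by auto
  have "?\<mu> (\<lambda>j. u j + t * v j) \<in> C"
  proof (rule PRT_ge[OF C(1) z])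
    show "z i = 0 \<and> ?\<mu> (\<lambda>j. u j + t * v j) i = 0" if "m \<le> i" for i
      using z C(3) that by (auto simp: topspace_Euclidean_space affine_map_def)
    show "z i \<le> ?\<mu> (\<lambda>j. u j + t * v j) i" if "i < m" for i
      using t that by (simp add: affine_map_add)
  qed
  then show ?thesis using t by blast
qed

text \<open>
  If \<open>g = 0\<close>, then \<open>f\<close> vanishes as a function on the real space, and its leading coefficients vanish because
  they are differences. Otherwise \<open>g\<close> has a component \<open>C\<close>, and at points of \<open>C\<close> all derivatives
  of \<open>g\<close> are nonnegative; this makes \<open>f\<close> monotone, with nonnegative second differences, in nonnegative directions from the
  points that \<open>\<mu>\<close> maps into \<open>C\<close>.
\<close>

theorem garding_degree_le_2_imp_S_n:
  assumes "garding n f" and deg: "total_degree f \<le> 2"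
  shows "f \<in> S_n n"
proof -
  have f: "f \<in> polys n" using assms by (simp add: garding_def)
  obtain m g A b where mg: "multi_affine_garding m g" and A: "strictly_positive_matrix m n A"
    and "\<forall>x \<in> topspace (Euclidean_space n). eval_poly f x = eval_poly g (affine_map m n A b x)"
    using assms(1) unfolding garding_def strictly_positive_affine_def by blast
  then have F: "eval_poly f x = eval_poly g (affine_map m n A b x)" if "\<And>i. n \<le> i \<Longrightarrow> x i = 0" for x
    using that by (simp add: topspace_Euclidean_space)
  have g: "g \<in> polys m" "multi_affine g" and gc: "garding_component m g \<noteq> {}"
    using mg by (auto simp: multi_affine_garding_def)
  show ?thesis
  proof (cases "g = 0")
    case True
    then have F0: "eval_poly f x = 0" if "\<And>i. n \<le> i \<Longrightarrow> x i = 0" for x :: "nat \<Rightarrow> real"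
      using F[of x] that by (simp add: eval_poly_def)
    have "f = 0"
    proof (rule ccontr)
      assume "f \<noteq> 0"
      then obtain k where k: "k \<in> Poly_Mapping.keys f" "monom_degree k = total_degree f"
        using total_degree_attained by blast
      obtain r :: real and p q where r: "0 < r" and "\<forall>l. 0 \<le> p l" "\<forall>l. 0 \<le> q l"
        and pq: "\<forall>l\<ge>n. p l = 0 \<and> q l = 0"
        and eq: "Poly_Mapping.lookup f k * r \<in> {eval_poly f (\<lambda>_. 0),
          eval_poly f (\<lambda>l. 0 + p l) - eval_poly f (\<lambda>_. 0),
          eval_poly f (\<lambda>l. 0 + (p l + q l)) - eval_poly f (\<lambda>l. 0 + p l)
            - eval_poly f (\<lambda>l. 0 + q l) + eval_poly f (\<lambda>_. 0)}"
        by (rule top_coeff_difference[OF f deg k, where x = "\<lambda>_. 0"])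
      then have "Poly_Mapping.lookup f k * r = 0" by (simp add: F0 pq)
      then show False using r k by (simp add: in_keys_iff)
    qed
    then show ?thesis by (simp add: S_n_def real_stable_def polys_def nonneg_coeffs_def lookup_top_part)
  next
    case False
    then obtain C where C: "PRT_component m g C" using gc garding_component_nonempty_iff by blast
    have PC: "PRT m C" "C \<noteq> {}" "C \<subseteq> topspace (Euclidean_space m)"
      using C PRT_component_nonempty[OF C] PRT_component_subset[OF C] pos_set_subset
      by (auto simp: PRT_component_def)
    let ?\<mu> = "affine_map m n A b" and ?L = "linear_part m n A"
    let ?c = "\<lambda>S. Poly_Mapping.lookup g (squarefree_monom S)"
    have pos: "0 < eval_poly g z" if "z \<in> C" for z
      using PRT_component_subset[OF C] that by (auto simp: pos_set_def)
    have local: "eval_poly f (\<lambda>j. x j + w j) = setpoly {..<m} (taylor {..<m} ?c (?\<mu> x)) (?L w)"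
      if "\<And>i. n \<le> i \<Longrightarrow> x i = 0" "\<And>i. n \<le> i \<Longrightarrow> w i = 0" for x w
    proof -
      have "eval_poly f (\<lambda>j. x j + w j) = eval_poly g (?\<mu> (\<lambda>j. x j + w j))"
        using that by (intro F) simp
      also have "?\<mu> (\<lambda>j. x j + w j) = (\<lambda>i. ?\<mu> x i + ?L w i)"
        using affine_map_add[of m n A b x 1 w] by simp
      finally show ?thesis by (simp add: eval_multi_affine[OF g] setpoly_add)
    qed
    have L0: "?L (\<lambda>_. 0) = (\<lambda>_. 0)" by (auto simp: linear_part_def)
    have base: "eval_poly f x = setpoly {..<m} (taylor {..<m} ?c (?\<mu> x)) (\<lambda>_. 0)"
      if "\<And>i. n \<le> i \<Longrightarrow> x i = 0" for x
      using local[of x "\<lambda>_. 0"] that unfolding L0 by simp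
    have nonneg: "0 \<le> taylor {..<m} ?c z S" if "z \<in> C" "S \<subseteq> {..<m}" for z S
      using PRT_component_taylor_nonneg[OF g C that] .
    have mono: "eval_poly f x \<le> eval_poly f (\<lambda>j. x j + w j)"
      if "\<And>i. n \<le> i \<Longrightarrow> x i = 0" "\<And>i. n \<le> i \<Longrightarrow> w i = 0" "?\<mu> x \<in> C" "\<And>i. 0 \<le> w i" for x w
    proof -
      have "setpoly {..<m} (taylor {..<m} ?c (?\<mu> x)) (\<lambda>_. 0) \<le> setpoly {..<m} (taylor {..<m} ?c (?\<mu> x)) (?L w)"
        using linear_part_nonneg[OF A, of w] that(4) by (intro setpoly_mono nonneg[OF that(3)]) auto
      then show ?thesis
        using local[OF that(1,2)] base[OF that(1)] by simp
    qed
    have stable: "real_stable n f"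
      unfolding real_stable_def
    proof (intro disjI2 allI impI notI)
      fix x :: "nat \<Rightarrow> complex" assume x: "\<forall>i<n. 0 < Im (x i)" and zero: "eval_poly f x = 0"
      define u v where "u = (\<lambda>i. if i < n then Re (x i) else 0)"
        and "v = (\<lambda>i. if i < n then Im (x i) else 0)"
      have uv: "u i = 0" "v i = 0" if "n \<le> i" for i using that by (auto simp: u_def v_def)
      have vpos: "0 < v i" if "i < n" for i using x that by (simp add: v_def)
      have vnn: "0 \<le> v i" for i using vpos[of i] uv[of i] by (cases "i < n") auto
      obtain \<alpha> \<beta> \<gamma> where q: "\<And>z :: complex. eval_poly f (\<lambda>i. of_real (u i) + z * of_real (v i))
          = of_real \<alpha> + of_real \<beta> * z + of_real \<gamma> * z\<^sup>2"
        using quadratic_along_line[OF deg, of u v] by blast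
      have "eval_poly f (\<lambda>i. of_real (u i) + \<i> * of_real (v i)) = eval_poly f x"
        unfolding eval_polys[OF f]
        by (intro sum.cong prod.cong refl arg_cong2[of _ _ _ _ "(*)"] arg_cong2[of _ _ _ _ "(^)"])
          (auto simp: u_def v_def complex_eq_iff)
      then have "of_real \<alpha> + of_real \<beta> * \<i> + of_real \<gamma> * \<i>\<^sup>2 = (0 :: complex)"
        using q[of \<i>] zero by simp
      then have "\<beta> = 0" "\<alpha> = \<gamma>" by (auto simp: complex_eq_iff)
      have qr: "eval_poly f (\<lambda>i. u i + t * v i) = \<gamma> * (1 + t\<^sup>2)" for t
      proof -
        have "complex_of_real (eval_poly f (\<lambda>i. u i + t * v i))
            = eval_poly f (\<lambda>i. of_real (u i) + of_real t * of_real (v i))"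
          using eval_poly_of_real[where 'a = complex, of f "\<lambda>i. u i + t * v i"] by simp
        also have "\<dots> = of_real (\<gamma> * (1 + t\<^sup>2))"
          unfolding q \<open>\<beta> = 0\<close> \<open>\<alpha> = \<gamma>\<close> by (simp add: algebra_simps)
        finally show ?thesis by (simp only: of_real_eq_iff)
      qed
      have line: "eval_poly g (?\<mu> (\<lambda>i. u i + t * v i)) = \<gamma> * (1 + t\<^sup>2)" for t
        using F[of "\<lambda>i. u i + t * v i"] uv qr[of t] by simp
      obtain T where T: "?\<mu> (\<lambda>j. u j + T * v j) \<in> C"
        using positive_ray_enters[OF A PC, of v b u] vpos by blast
      have sq: "0 < 1 + t\<^sup>2" for t :: real by (simp add: add_pos_nonneg)
      have "0 < \<gamma>" using pos[OF T] line[of T] sq[of T] by (simp add: zero_less_mult_iff)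
      \<comment> \<open>The line never leaves \<open>{g > 0}\<close>, so it can be followed backwards past its minimum at \<open>t = 0\<close>.\<close>
      have low: "?\<mu> (\<lambda>j. u j + (- 1) * v j) \<in> C"
      proof (rule PRT_component_segment[OF C T])
        show "?\<mu> (\<lambda>j. u j + (- 1) * v j) i = 0" if "m \<le> i" for i
          using that by (simp add: affine_map_def)
        fix s :: real
        have "(\<lambda>i. ?\<mu> (\<lambda>j. u j + T * v j) i + s * (?\<mu> (\<lambda>j. u j + (- 1) * v j) i - ?\<mu> (\<lambda>j. u j + T * v j) i))
            = ?\<mu> (\<lambda>j. u j + (T + s * (- 1 - T)) * v j)"
          unfolding affine_map_add by (simp add: fun_eq_iff algebra_simps)
        then show "0 < eval_poly g (\<lambda>i. ?\<mu> (\<lambda>j. u j + T * v j) i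
            + s * (?\<mu> (\<lambda>j. u j + (- 1) * v j) i - ?\<mu> (\<lambda>j. u j + T * v j) i))"
          using line \<open>0 < \<gamma>\<close> sq by simp
      qed
      \<comment> \<open>Monotonicity from \<open>t = -1\<close> to \<open>t = 0\<close> would give \<open>2 * \<gamma> \<le> \<gamma>\<close>.\<close>
      have "eval_poly f (\<lambda>j. u j + (- 1) * v j) \<le> eval_poly f (\<lambda>j. (u j + (- 1) * v j) + v j)"
        using uv vnn low by (intro mono) auto
      then show False using qr[of "-1"] qr[of 0] \<open>0 < \<gamma>\<close> by simp
    qed
    have top: "nonneg_coeffs (top_part f)"
      unfolding nonneg_coeffs_def lookup_top_part
    proof (intro allI)
      fix k
      have "0 \<le> Poly_Mapping.lookup f k" if k: "k \<in> Poly_Mapping.keys f" "monom_degree k = total_degree f"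
      proof -
        obtain t where t: "?\<mu> (\<lambda>j. 0 + t * (if j < n then 1 else 0)) \<in> C"
          using positive_ray_enters[OF A PC, of "\<lambda>j. if j < n then 1 else 0" b "\<lambda>_. 0"] by auto
        define x where "x = (\<lambda>j. 0 + t * (if j < n then 1 else 0))"
        have x0: "x i = 0" if "n \<le> i" for i using that by (simp add: x_def)
        have xC: "?\<mu> x \<in> C" using t by (simp add: x_def)
        obtain r :: real and p q where r: "0 < r" and p: "\<forall>l. 0 \<le> p l" and q: "\<forall>l. 0 \<le> q l"
          and pq: "\<forall>l\<ge>n. p l = 0 \<and> q l = 0"
          and eq: "Poly_Mapping.lookup f k * r \<in> {eval_poly f x,
            eval_poly f (\<lambda>l. x l + p l) - eval_poly f x,
            eval_poly f (\<lambda>l. x l + (p l + q l)) - eval_poly f (\<lambda>l. x l + p l)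
              - eval_poly f (\<lambda>l. x l + q l) + eval_poly f x}"
          by (rule top_coeff_difference[OF f deg k, where x = x])
        have "0 \<le> eval_poly f x" using pos[OF xC] F[of x] x0 by simp
        moreover have "0 \<le> eval_poly f (\<lambda>l. x l + p l) - eval_poly f x"
          using mono[of x p] x0 pq xC p by simp
        moreover have "0 \<le> eval_poly f (\<lambda>l. x l + (p l + q l)) - eval_poly f (\<lambda>l. x l + p l)
              - eval_poly f (\<lambda>l. x l + q l) + eval_poly f x"
        proof -
          have p0: "p i = 0" "q i = 0" "p i + q i = 0" if "n \<le> i" for i using pq that by auto
          have "0 \<le> setpoly {..<m} (taylor {..<m} ?c (?\<mu> x)) (\<lambda>i. ?L p i + ?L q i)
              - setpoly {..<m} (taylor {..<m} ?c (?\<mu> x)) (?L p)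
              - setpoly {..<m} (taylor {..<m} ?c (?\<mu> x)) (?L q)
              + setpoly {..<m} (taylor {..<m} ?c (?\<mu> x)) (\<lambda>_. 0)"
            using p q linear_part_nonneg[OF A]
            by (intro setpoly_second_difference_nonneg nonneg[OF xC]) auto
          then show ?thesis
            using local[of x p] local[of x q] local[of x "\<lambda>l. p l + q l"] base[of x] x0 p0
            by (simp add: linear_part_add)
        qed
        ultimately have "0 \<le> Poly_Mapping.lookup f k * r" using eq by auto
        then show ?thesis using r by (simp add: zero_le_mult_iff)
      qed
      then show "0 \<le> (if monom_degree k = total_degree f then Poly_Mapping.lookup f k else 0)"
        by (cases "k \<in> Poly_Mapping.keys f") (auto simp: in_keys_iff)
    qed
    show ?thesis using f stable top by (simp add: S_n_def)
  qed
qed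

theorem theorem4p16:
  shows "(\<forall>n. S_n n \<subseteq> G_n n) \<and> S_all \<subset> G_all
    \<and> {f \<in> G_all. total_degree f \<le> 2} = {f \<in> S_all. total_degree f \<le> 2}"
proof (intro conjI allI)
  show "S_n n \<subseteq> G_n n" for n by (rule S_n_subset_G_n)
  have sub: "S_all \<subseteq> G_all" using S_n_subset_G_n by (auto simp: S_all_def G_all_def)
  then show "S_all \<subset> G_all" using S_all_neq_G_all by blast
  show "{f \<in> G_all. total_degree f \<le> 2} = {f \<in> S_all. total_degree f \<le> 2}"
  proof (intro equalityI subsetI)
    fix f assume "f \<in> {f \<in> G_all. total_degree f \<le> 2}"
    then obtain n where "garding n f" "total_degree f \<le> 2" by (auto simp: G_all_def G_n_def)
    then show "f \<in> {f \<in> S_all. total_degree f \<le> 2}"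
      using garding_degree_le_2_imp_S_n by (auto simp: S_all_def)
  qed (use sub in auto)
qed

end
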